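(* Let $\rho\in(0,1)$. There exist positive constants $N_0,C,c$ depending only on $\rho$ such that for all $r>0$ and all $N\ge N_0$, $$\mathbb{P}^{\rho}\left(|Z^{\mathbf{0}\to v_N}|\ge rN^{2/3}\right)\le Ce^{-cr^3},$$ where $v_N=((1-\rho)^2N,\rho^2N)$ and $Z^{\mathbf 0\to v_N}$ is the exit time of the stationary geodesic from $\mathbf 0$ to $v_N$ in the boundary representation of stationary exponential last passage percolation with density $\rho$.
   Context: Boundary representation of stationary LPP with density $\rho\in(0,1)$: let $\mathrm e_1=(1,0)$, $\mathrm e_2=(0,1)$, $\mathbf 0=(0,0)$. Let $\omega'=\{\omega'_v:v\in\mathbb{Z}^2_{\ge0}\}$ be independent with $\omega'_{\mathbf 0}=0$, $\omega'_v\sim\mathrm{exp}(1)$ for $v\in\mathbb{Z}^2_{>0}$, $\omega'_{i\mathrm e_1}\sim\mathrm{exp}(1-\rho)$ and $\omega'_{j\mathrm e_2}\sim\mathrm{exp}(\rho)$ for $i,j\ge1$, where $\mathrm{exp}(\lambda)$ is the exponential law with rate $\lambda$ (mean $1/\lambda$). Probabilities for this model are denoted $\mathbb{P}^\rho$. An up-right path is a lattice path with steps $\mathrm e_1,\mathrm e_2$; the weight of a path is the sum of the $\omega'$ over all its vertices (including endpoints). The stationary geodesic to $v$ is the a.s. unique up-right path from $\mathbf 0$ to $v$ of maximal weight. Exit time: $Z^{\mathbf 0\to v_N}$ is the non-zero coordinate of the point at which the stationary geodesic from $\mathbf 0$ to $v_N$ exits the coordinate axes (i.e. its last point on the axes),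 taken with positive sign if this point is on the $x$-axis and negative sign if it is on the $y$-axis. Rounding convention: non-integer coordinates are rounded to integers (e.g. by taking the floor); $N$ is a positive integer. *)

theory Defs
  imports "HOL-Probability.Probability"
begin

text \<open>The quadrant \<open>\<int>\<^sup>2\<^sub>\<ge>\<^sub>0\<close> is represented by the type \<^typ>\<open>nat \<times> nat\<close>.\<close>

definition weight_law :: "real \<Rightarrow> nat \<times> nat \<Rightarrow> real measure" where
  "weight_law \<rho> v =
     (if v = (0, 0) then return borel 0
      else if snd v = 0 then density lborel (exponential_density (1 - \<rho>))
      else if fst v = 0 then density lborel (exponential_density \<rho>)
      else density lborel (exponential_density 1))"

text \<open>The measure \<open>\<P>\<^sup>\<rho>\<close>, realised on the canonical space of weight configurations: under it the
  coordinates are independent with the prescribed marginals.\<close>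

definition stationary_lpp :: "real \<Rightarrow> (nat \<times> nat \<Rightarrow> real) measure" where
  "stationary_lpp \<rho> = (\<Pi>\<^sub>M v\<in>UNIV. weight_law \<rho> v)"

definition up_right_path :: "nat \<times> nat \<Rightarrow> nat \<times> nat \<Rightarrow> (nat \<times> nat) list \<Rightarrow> bool" where
  "up_right_path u v \<pi> \<longleftrightarrow>
     \<pi> \<noteq> [] \<and> hd \<pi> = u \<and> last \<pi> = v \<and>
     successively (\<lambda>x y. y = x + (1, 0) \<or> y = x + (0, 1)) \<pi>"

definition path_weight :: "(nat \<times> nat \<Rightarrow> real) \<Rightarrow> (nat \<times> nat) list \<Rightarrow> real" where
  "path_weight \<omega> \<pi> = (\<Sum>x\<leftarrow>\<pi>. \<omega> x)"

definition is_geodesic ::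
  "(nat \<times> nat \<Rightarrow> real) \<Rightarrow> nat \<times> nat \<Rightarrow> nat \<times> nat \<Rightarrow> (nat \<times> nat) list \<Rightarrow> bool" where
  "is_geodesic \<omega> u v \<pi> \<longleftrightarrow>
     up_right_path u v \<pi> \<and> (\<forall>\<pi>'. up_right_path u v \<pi>' \<longrightarrow> path_weight \<omega> \<pi>' \<le> path_weight \<omega> \<pi>)"

definition exit_point :: "(nat \<times> nat) list \<Rightarrow> nat \<times> nat" where
  "exit_point \<pi> = last (filter (\<lambda>x. fst x = 0 \<or> snd x = 0) \<pi>)"

definition signed_exit :: "(nat \<times> nat) list \<Rightarrow> int" where
  "signed_exit \<pi> =
     (let x = exit_point \<pi> in if snd x = 0 then int (fst x) else - int (snd x))"

text \<open>The geodesic from the origin is only almost surely unique. On the null event where it is not,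
  the exit time is set to \<open>0\<close>, so that it is a measurable function of the weights everywhere (an
  unguarded description operator would leave its values there unspecified).\<close>

definition exit_time :: "(nat \<times> nat \<Rightarrow> real) \<Rightarrow> nat \<times> nat \<Rightarrow> int" where
  "exit_time \<omega> v =
     (if \<exists>!\<pi>. is_geodesic \<omega> (0, 0) v \<pi> then signed_exit (THE \<pi>. is_geodesic \<omega> (0, 0) v \<pi>) else 0)"

definition char_point :: "real \<Rightarrow> nat \<Rightarrow> nat \<times> nat" where
  "char_point \<rho> N = (nat \<lfloor>(1 - \<rho>)\<^sup>2 * real N\<rfloor>, nat \<lfloor>\<rho>\<^sup>2 * real N\<rfloor>)"

lemma sets_weight_law [measurable_cong]: "sets (weight_law \<rho> v) = sets borel"
  by (simp add: weight_law_def)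

lemma prob_space_weight_law:
  assumes "0 < \<rho>" "\<rho> < 1"
  shows "prob_space (weight_law \<rho> v)"
  using assms by (auto simp: weight_law_def intro!: prob_space_return prob_space_exponential_density)

lemma prob_space_stationary_lpp:
  assumes "0 < \<rho>" "\<rho> < 1"
  shows "prob_space (stationary_lpp \<rho>)"
  unfolding stationary_lpp_def using prob_space_weight_law[OF assms] by (rule prob_space_PiM)

lemma measurable_path_weight [measurable]:
  "(\<lambda>\<omega>. path_weight \<omega> \<pi>) \<in> borel_measurable (stationary_lpp \<rho>)"
proof (induction \<pi>)
  case Nil
  then show ?case by (simp add: path_weight_def)
next
  case (Cons x \<pi>)
  have "(\<lambda>\<omega>. \<omega> x) \<in> measurable (stationary_lpp \<rho>) (weight_law \<rho> x)"
    unfolding stationary_lpp_def by (rule measurable_component_singleton) simp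
  then have "(\<lambda>\<omega>. \<omega> x) \<in> borel_measurable (stationary_lpp \<rho>)"
    by (simp add: measurable_cong_sets[OF refl sets_weight_law])
  with Cons show ?case by (simp add: path_weight_def)
qed

lemma measurable_exit_time [measurable]:
  "(\<lambda>\<omega>. exit_time \<omega> v) \<in> measurable (stationary_lpp \<rho>) (count_space UNIV)"
proof -
  have [measurable]: "Measurable.pred (stationary_lpp \<rho>)
      (\<lambda>\<omega>. path_weight \<omega> \<pi>' \<le> path_weight \<omega> \<pi>)" for \<pi> \<pi>'
    unfolding pred_def by (intro borel_measurable_le measurable_path_weight)
  have [measurable]: "Measurable.pred (stationary_lpp \<rho>) (\<lambda>\<omega>. is_geodesic \<omega> (0, 0) v \<pi>)" for \<pi>
    unfolding is_geodesic_def by measurable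
  have eq: "exit_time \<omega> v = z \<longleftrightarrow>
      (\<exists>\<pi>. is_geodesic \<omega> (0, 0) v \<pi> \<and> (\<forall>\<pi>'. is_geodesic \<omega> (0, 0) v \<pi>' \<longrightarrow> \<pi>' = \<pi>) \<and> signed_exit \<pi> = z) \<or>
      (\<not> (\<exists>\<pi>. is_geodesic \<omega> (0, 0) v \<pi> \<and> (\<forall>\<pi>'. is_geodesic \<omega> (0, 0) v \<pi>' \<longrightarrow> \<pi>' = \<pi>)) \<and> z = 0)"
    for \<omega> z
  proof (cases "\<exists>!\<pi>. is_geodesic \<omega> (0, 0) v \<pi>")
    case True
    then obtain \<pi> where \<pi>: "is_geodesic \<omega> (0, 0) v \<pi>" "\<And>\<pi>'. is_geodesic \<omega> (0, 0) v \<pi>' \<Longrightarrow> \<pi>' = \<pi>"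
      by blast
    then have "(THE \<pi>. is_geodesic \<omega> (0, 0) v \<pi>) = \<pi>" by blast
    with True have "exit_time \<omega> v = signed_exit \<pi>" by (simp add: exit_time_def)
    with \<pi> show ?thesis by metis
  next
    case False
    then have "exit_time \<omega> v = 0" by (simp only: exit_time_def if_False)
    with False show ?thesis by metis
  qed
  have "Measurable.pred (stationary_lpp \<rho>) (\<lambda>\<omega>. exit_time \<omega> v = z)" for z
    unfolding eq by measurable
  then show ?thesis
    by (intro measurable_count_space_eq_countable[THEN iffD2])
      (auto simp: pred_def vimage_def Int_def conj_commute)
qed

end

theory Submission imports Defs begin

text \<open>The proof is a coupling argument that needs no information on last-passage fluctuations beyond one
exact moment generating function. Write \<open>a = 1 - \<rho>\<close> for the rate on the horizontal axis, so that the
vertical axis carries rate \<open>1 - a\<close>, and let \<open>f(x) = m / x + n / (1 - x)\<close> be the mean last-passage time to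
\<open>(m, n)\<close> in the stationary model with horizontal rate \<open>x\<close>, with primitive \<open>F(x) = m ln x - n ln (1 - x)\<close>.

Burke's theorem enters as a measure-preserving map. The map \<open>flip i j\<close> replaces the increments
entering the corner \<open>(i, j)\<close> by those leaving it and stores the minimum of the former in place of the
bulk weight; it preserves the product law of all weights (\<open>distr_flip\<close>). After flipping the columns
\<open>1, \<dots>, k\<close> up to row \<open>n\<close>, the configuration has its old law, but its vertical axis carries the increments
of the last-passage time along the line \<open>x = k\<close>, and its first \<open>k\<close> horizontal axis weights are the
increments along the row \<open>y = n\<close> (\<open>flip_columns_increments\<close>). Two consequences are used.

First, rooting the model at \<open>(k, 0)\<close> with these increments as boundary gives again the stationary model
(\<open>distr_reroot\<close>). If the geodesic to \<open>(m, n)\<close> leaves the horizontal axis beyond \<open>k\<close>, then in the new model the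
best path to \<open>(m - k, n)\<close> that starts along the horizontal axis is at least as heavy as the best path that
starts along the vertical axis (\<open>exit_time_imp_hor_wins\<close>). Call their weights \<open>hor\<close> and \<open>ver\<close>; the
last-passage time is the larger of the two.

Second, if the horizontal rate is \<open>z\<close> and the vertical rate is \<open>1 - w\<close>, the last-passage time \<open>G\<close> satisfies
\<open>E exp ((z - w) G) = exp (F(z) - F(w))\<close> for all \<open>z\<close> and \<open>w\<close> in \<open>(0, 1)\<close> (\<open>nn_integral_exp_lpp\<close>): tilting the vertical
weights makes the model stationary, and what remains of \<open>G\<close> is a sum of \<open>m\<close> independent exponentials.
This controls the upper tail for \<open>w < z\<close> and the lower tail for \<open>z < w\<close>.

Now take \<open>f\<close> and \<open>F\<close> for the endpoint \<open>(m - k, n)\<close> and let \<open>w < z < a\<close>. Lowering the horizontal rate from \<open>a\<close> to \<open>z\<close> increases \<open>hor\<close> and leaves \<open>ver\<close> alone.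
So if \<open>ver \<le> hor\<close> in the stationary model, then for any level \<open>s\<close> either the last-passage time with rates
\<open>(z, 1 - a)\<close> is at most \<open>s\<close>, or \<open>hor\<close> at horizontal rate \<open>z\<close> is at least \<open>s\<close>; since \<open>hor\<close> ignores the vertical
weights, in the latter case the last-passage time with rates \<open>(z, 1 - w)\<close> is at least \<open>s\<close>. The two
Chernoff exponents are the integrals of \<open>f - s\<close> over \<open>[z, a]\<close> and of \<open>s - f\<close> over \<open>[w, z]\<close>
(\<open>prob_ver_le_hor\<close>). For \<open>s = f(z)\<close> both are at least \<open>\<kappa> h\<^sup>2 / 2\<close> if the interval lengths are \<open>h\<close> and \<open>f\<close> has
slope at least \<open>\<kappa>\<close> on \<open>[w, a]\<close>. Because \<open>(m - k, n)\<close> lies off the characteristic direction of \<open>a\<close>, this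
holds with \<open>\<kappa>\<close> of order \<open>k\<close> and \<open>h\<close> of order \<open>k / N\<close>, which gives the exponent \<open>k\<^sup>3 / N\<^sup>2\<close>, that is, \<open>r\<^sup>3\<close> for
\<open>k = r N\<^bsup>2/3\<^esup>\<close>. Transposing the quadrant gives the same bound for the vertical axis.\<close>

section \<open>Burke's theorem at one corner\<close>

lemma nn_integral_lborel_swap:
  fixes h :: "real \<times> real \<Rightarrow> ennreal"
  assumes [measurable]: "h \<in> borel_measurable (borel \<Otimes>\<^sub>M borel)"
  shows "(\<integral>\<^sup>+x. \<integral>\<^sup>+y. h (x, y) \<partial>lborel \<partial>lborel) = (\<integral>\<^sup>+y. \<integral>\<^sup>+x. h (x, y) \<partial>lborel \<partial>lborel)"
  by (intro lborel_pair.Fubini'[symmetric]) simp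

text \<open>The coordinates are the minimum \<open>m\<close> of the two variables and the absolute value \<open>d\<close> of their
difference; the corner flip fixes the signed difference.\<close>
lemma nn_integral_split_at_min:
  fixes g :: "real \<times> real \<Rightarrow> ennreal"
  assumes [measurable]: "g \<in> borel_measurable (borel \<Otimes>\<^sub>M borel)"
  shows "(\<integral>\<^sup>+x. \<integral>\<^sup>+y. g (x, y) \<partial>lborel \<partial>lborel) =
    (\<integral>\<^sup>+m. \<integral>\<^sup>+d. indicator {0..} d * g (m + d, m) + indicator {0<..} d * g (m, m + d) \<partial>lborel \<partial>lborel)"
proof -
  let ?P = "\<lambda>x y. indicator {0..} (x - y) * g (x, y) :: ennreal"
  let ?Q = "\<lambda>x y. indicator {0<..} (y - x) * g (x, y) :: ennreal"
  have "(\<integral>\<^sup>+x. \<integral>\<^sup>+y. g (x, y) \<partial>lborel \<partial>lborel) = (\<integral>\<^sup>+x. \<integral>\<^sup>+y. (?P x y + ?Q x y) \<partial>lborel \<partial>lborel)"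
    by (intro nn_integral_cong) (auto simp: indicator_def)
  also have "\<dots> = (\<integral>\<^sup>+x. (\<integral>\<^sup>+y. ?P x y \<partial>lborel) + (\<integral>\<^sup>+y. ?Q x y \<partial>lborel) \<partial>lborel)"
    by (intro nn_integral_cong nn_integral_add) measurable
  also have "\<dots> = (\<integral>\<^sup>+x. \<integral>\<^sup>+y. ?P x y \<partial>lborel \<partial>lborel) + (\<integral>\<^sup>+x. \<integral>\<^sup>+y. ?Q x y \<partial>lborel \<partial>lborel)"
    by (intro nn_integral_add) measurable
  also have "(\<integral>\<^sup>+x. \<integral>\<^sup>+y. ?P x y \<partial>lborel \<partial>lborel) = (\<integral>\<^sup>+y. \<integral>\<^sup>+x. ?P x y \<partial>lborel \<partial>lborel)"
    using nn_integral_lborel_swap[of "\<lambda>(x, y). ?P x y"] by simp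
  also have "\<dots> = (\<integral>\<^sup>+m. \<integral>\<^sup>+d. indicator {0..} d * g (m + d, m) \<partial>lborel \<partial>lborel)"
  proof (rule nn_integral_cong)
    fix m :: real
    show "(\<integral>\<^sup>+x. ?P x m \<partial>lborel) = (\<integral>\<^sup>+d. indicator {0..} d * g (m + d, m) \<partial>lborel)"
      by (subst nn_integral_real_affine[where t = m and c = 1]) auto
  qed
  also have "(\<integral>\<^sup>+x. \<integral>\<^sup>+y. ?Q x y \<partial>lborel \<partial>lborel) = (\<integral>\<^sup>+m. \<integral>\<^sup>+d. indicator {0<..} d * g (m, m + d) \<partial>lborel \<partial>lborel)"
  proof (rule nn_integral_cong)
    fix m :: real
    show "(\<integral>\<^sup>+x. ?Q m x \<partial>lborel) = (\<integral>\<^sup>+d. indicator {0<..} d * g (m, m + d) \<partial>lborel)"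
      by (subst nn_integral_real_affine[where t = m and c = 1]) auto
  qed
  also have "(\<integral>\<^sup>+m. \<integral>\<^sup>+d. indicator {0..} d * g (m + d, m) \<partial>lborel \<partial>lborel) +
      (\<integral>\<^sup>+m. \<integral>\<^sup>+d. indicator {0<..} d * g (m, m + d) \<partial>lborel \<partial>lborel) =
    (\<integral>\<^sup>+m. (\<integral>\<^sup>+d. indicator {0..} d * g (m + d, m) \<partial>lborel) + (\<integral>\<^sup>+d. indicator {0<..} d * g (m, m + d) \<partial>lborel) \<partial>lborel)"
    by (intro nn_integral_add[symmetric]) measurable
  also have "\<dots> = (\<integral>\<^sup>+m. \<integral>\<^sup>+d. indicator {0..} d * g (m + d, m) + indicator {0<..} d * g (m, m + d) \<partial>lborel \<partial>lborel)"
    by (intro nn_integral_cong nn_integral_add[symmetric]) measurable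
  finally show ?thesis .
qed

abbreviation exp_law :: "real \<Rightarrow> real measure" where
  "exp_law l \<equiv> density lborel (exponential_density l)"

lemma nn_integral_exp_law3:
  fixes f :: "real \<times> real \<times> real \<Rightarrow> ennreal"
  assumes pos: "0 < a" "0 < b" "0 < c"
  assumes [measurable]: "f \<in> borel_measurable (borel \<Otimes>\<^sub>M borel \<Otimes>\<^sub>M borel)"
  shows "(\<integral>\<^sup>+x. \<integral>\<^sup>+y. \<integral>\<^sup>+u. f (x, y, u) \<partial>exp_law c \<partial>exp_law b \<partial>exp_law a) =
    (\<integral>\<^sup>+x. \<integral>\<^sup>+y. \<integral>\<^sup>+u. ennreal (exponential_density a x * exponential_density b y * exponential_density c u) * f (x, y, u)
       \<partial>lborel \<partial>lborel \<partial>lborel)"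
proof -
  have nn: "0 \<le> exponential_density a x" "0 \<le> exponential_density b x" "0 \<le> exponential_density c x" for x
    using pos by (auto simp: exponential_density_def)
  have "(\<integral>\<^sup>+x. \<integral>\<^sup>+y. \<integral>\<^sup>+u. f (x, y, u) \<partial>exp_law c \<partial>exp_law b \<partial>exp_law a) =
    (\<integral>\<^sup>+x. \<integral>\<^sup>+y. (\<integral>\<^sup>+u. ennreal (exponential_density c u) * f (x, y, u) \<partial>lborel) \<partial>exp_law b \<partial>exp_law a)"
    by (intro nn_integral_cong nn_integral_density) measurable
  also have "\<dots> = (\<integral>\<^sup>+x. (\<integral>\<^sup>+y. ennreal (exponential_density b y) *
       (\<integral>\<^sup>+u. ennreal (exponential_density c u) * f (x, y, u) \<partial>lborel) \<partial>lborel) \<partial>exp_law a)"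
    by (intro nn_integral_cong nn_integral_density) measurable
  also have "\<dots> = (\<integral>\<^sup>+x. ennreal (exponential_density a x) * (\<integral>\<^sup>+y. ennreal (exponential_density b y) *
       (\<integral>\<^sup>+u. ennreal (exponential_density c u) * f (x, y, u) \<partial>lborel) \<partial>lborel) \<partial>lborel)"
    by (intro nn_integral_density) measurable
  also have "\<dots> = (\<integral>\<^sup>+x. ennreal (exponential_density a x) * (\<integral>\<^sup>+y. \<integral>\<^sup>+u. ennreal (exponential_density b y) *
       (ennreal (exponential_density c u) * f (x, y, u)) \<partial>lborel \<partial>lborel) \<partial>lborel)"
    by (intro nn_integral_cong arg_cong2[where f = "(*)"] refl nn_integral_cmult[symmetric]) measurable
  also have "\<dots> = (\<integral>\<^sup>+x. \<integral>\<^sup>+y. ennreal (exponential_density a x) * (\<integral>\<^sup>+u. ennreal (exponential_density b y) *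
       (ennreal (exponential_density c u) * f (x, y, u)) \<partial>lborel) \<partial>lborel \<partial>lborel)"
    by (intro nn_integral_cong nn_integral_cmult[symmetric]) measurable
  also have "\<dots> = (\<integral>\<^sup>+x. \<integral>\<^sup>+y. \<integral>\<^sup>+u. ennreal (exponential_density a x) * (ennreal (exponential_density b y) *
       (ennreal (exponential_density c u) * f (x, y, u))) \<partial>lborel \<partial>lborel \<partial>lborel)"
    by (intro nn_integral_cong nn_integral_cmult[symmetric]) measurable
  also have "\<dots> = (\<integral>\<^sup>+x. \<integral>\<^sup>+y. \<integral>\<^sup>+u. ennreal (exponential_density a x * exponential_density b y * exponential_density c u) * f (x, y, u)
       \<partial>lborel \<partial>lborel \<partial>lborel)"
    using nn by (simp add: ennreal_mult mult.assoc)
  finally show ?thesis .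
qed

text \<open>The incoming increments \<open>x\<close>, \<open>y\<close> and the bulk weight \<open>u\<close> are mapped to the outgoing increments and
\<open>min x y\<close>. Since the outgoing increments have minimum \<open>u\<close> and the same difference \<open>x - y\<close>, the map exchanges
\<open>min x y\<close> with \<open>u\<close>. The joint density is proportional to
\<open>exp (- (a + b) (min x y + u) - a (x - y)\<^sup>+ - b (y - x)\<^sup>+)\<close>, which is symmetric in \<open>min x y\<close> and \<open>u\<close>.\<close>
lemma burke_corner:
  fixes f :: "real \<times> real \<times> real \<Rightarrow> ennreal"
  assumes pos: "0 < a" "0 < b"
  assumes [measurable]: "f \<in> borel_measurable (borel \<Otimes>\<^sub>M borel \<Otimes>\<^sub>M borel)"
  shows "(\<integral>\<^sup>+x. \<integral>\<^sup>+y. \<integral>\<^sup>+u. f (u + max (x - y) 0, u + max (y - x) 0, min x y) \<partial>exp_law (a + b) \<partial>exp_law b \<partial>exp_law a) =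
    (\<integral>\<^sup>+x. \<integral>\<^sup>+y. \<integral>\<^sup>+u. f (x, y, u) \<partial>exp_law (a + b) \<partial>exp_law b \<partial>exp_law a)"
proof -
  define K :: "real \<times> real \<times> real \<Rightarrow> ennreal" where "K = (\<lambda>(x, y, u). ennreal (exponential_density a x * exponential_density b y * exponential_density (a + b) u))"
  have [measurable]: "K \<in> borel_measurable (borel \<Otimes>\<^sub>M borel \<Otimes>\<^sub>M borel)"
    unfolding K_def by measurable
  have sym1: "K (m + d, m, u) = K (u + d, u, m)" if "0 \<le> d" for m d u
    using that by (auto simp: K_def exponential_density_def algebra_simps simp flip: exp_add intro!: arg_cong[where f = ennreal])
  have sym2: "K (m, m + d, u) = K (u, u + d, m)" if "0 < d" for m d u
    using that by (auto simp: K_def exponential_density_def algebra_simps simp flip: exp_add intro!: arg_cong[where f = ennreal])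
  define T where "T = (\<lambda>(m, d, u). indicator {0..} d * (K (m + d, m, u) * f (m + d, m, u)) +
      indicator {0<..} d * (K (m, m + d, u) * f (m, m + d, u)))"
  have [measurable]: "T \<in> borel_measurable (borel \<Otimes>\<^sub>M borel \<Otimes>\<^sub>M borel)"
    unfolding T_def by measurable
  have main: "(\<integral>\<^sup>+x. \<integral>\<^sup>+y. \<integral>\<^sup>+u. h (x, y, u) \<partial>exp_law (a + b) \<partial>exp_law b \<partial>exp_law a) =
      (\<integral>\<^sup>+m. \<integral>\<^sup>+d. \<integral>\<^sup>+u. indicator {0..} d * (K (m + d, m, u) * h (m + d, m, u)) +
      indicator {0<..} d * (K (m, m + d, u) * h (m, m + d, u)) \<partial>lborel \<partial>lborel \<partial>lborel)"
    if [measurable]: "h \<in> borel_measurable (borel \<Otimes>\<^sub>M borel \<Otimes>\<^sub>M borel)" for h :: "real \<times> real \<times> real \<Rightarrow> ennreal"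
  proof -
    have "(\<integral>\<^sup>+x. \<integral>\<^sup>+y. \<integral>\<^sup>+u. h (x, y, u) \<partial>exp_law (a + b) \<partial>exp_law b \<partial>exp_law a) =
      (\<integral>\<^sup>+x. \<integral>\<^sup>+y. \<integral>\<^sup>+u. K (x, y, u) * h (x, y, u) \<partial>lborel \<partial>lborel \<partial>lborel)"
      unfolding K_def prod.case using pos by (intro nn_integral_exp_law3) auto
    also have "\<dots> = (\<integral>\<^sup>+m. \<integral>\<^sup>+d. indicator {0..} d * (\<integral>\<^sup>+u. K (m + d, m, u) * h (m + d, m, u) \<partial>lborel)
      + indicator {0<..} d * (\<integral>\<^sup>+u. K (m, m + d, u) * h (m, m + d, u) \<partial>lborel) \<partial>lborel \<partial>lborel)"
      using nn_integral_split_at_min[of "\<lambda>(x, y). \<integral>\<^sup>+u. K (x, y, u) * h (x, y, u) \<partial>lborel"] by simp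
    also have "\<dots> = (\<integral>\<^sup>+m. \<integral>\<^sup>+d. (\<integral>\<^sup>+u. indicator {0..} d * (K (m + d, m, u) * h (m + d, m, u)) \<partial>lborel)
      + (\<integral>\<^sup>+u. indicator {0<..} d * (K (m, m + d, u) * h (m, m + d, u)) \<partial>lborel) \<partial>lborel \<partial>lborel)"
      by (intro nn_integral_cong arg_cong2[where f = "(+)"] nn_integral_cmult[symmetric]) measurable
    also have "\<dots> = (\<integral>\<^sup>+m. \<integral>\<^sup>+d. \<integral>\<^sup>+u. indicator {0..} d * (K (m + d, m, u) * h (m + d, m, u)) +
      indicator {0<..} d * (K (m, m + d, u) * h (m, m + d, u)) \<partial>lborel \<partial>lborel \<partial>lborel)"
      by (intro nn_integral_cong nn_integral_add[symmetric]) measurable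
    finally show ?thesis .
  qed
  have "(\<integral>\<^sup>+x. \<integral>\<^sup>+y. \<integral>\<^sup>+u. f (u + max (x - y) 0, u + max (y - x) 0, min x y) \<partial>exp_law (a + b) \<partial>exp_law b \<partial>exp_law a) =
    (\<integral>\<^sup>+m. \<integral>\<^sup>+d. \<integral>\<^sup>+u. T (u, d, m) \<partial>lborel \<partial>lborel \<partial>lborel)"
    using main[of "\<lambda>(x, y, u). f (u + max (x - y) 0, u + max (y - x) 0, min x y)"]
    by (auto simp: T_def indicator_def sym1 sym2 sym1[of 0, simplified] intro!: nn_integral_cong)
  also have "\<dots> = (\<integral>\<^sup>+d. \<integral>\<^sup>+m. \<integral>\<^sup>+u. T (u, d, m) \<partial>lborel \<partial>lborel \<partial>lborel)"
    using nn_integral_lborel_swap[of "\<lambda>(m, d). \<integral>\<^sup>+u. T (u, d, m) \<partial>lborel"] by simp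
  also have "\<dots> = (\<integral>\<^sup>+d. \<integral>\<^sup>+u. \<integral>\<^sup>+m. T (u, d, m) \<partial>lborel \<partial>lborel \<partial>lborel)"
    using nn_integral_lborel_swap[of "\<lambda>(m, u). T (u, d, m)" for d] by simp
  also have "\<dots> = (\<integral>\<^sup>+u. \<integral>\<^sup>+d. \<integral>\<^sup>+m. T (u, d, m) \<partial>lborel \<partial>lborel \<partial>lborel)"
    using nn_integral_lborel_swap[of "\<lambda>(d, u). \<integral>\<^sup>+m. T (u, d, m) \<partial>lborel"] by simp
  also have "\<dots> = (\<integral>\<^sup>+x. \<integral>\<^sup>+y. \<integral>\<^sup>+u. f (x, y, u) \<partial>exp_law (a + b) \<partial>exp_law b \<partial>exp_law a)"
    unfolding T_def prod.case by (rule main[symmetric]) measurable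
  finally show ?thesis .
qed

section \<open>Product laws with arbitrary rates\<close>

definition rate_law :: "(nat \<times> nat \<Rightarrow> real) \<Rightarrow> nat \<times> nat \<Rightarrow> real measure" where
  "rate_law \<mu> v = (if v = (0, 0) then return borel 0 else exp_law (\<mu> v))"

definition lpp_law :: "(nat \<times> nat \<Rightarrow> real) \<Rightarrow> (nat \<times> nat \<Rightarrow> real) measure" where
  "lpp_law \<mu> = (\<Pi>\<^sub>M v\<in>UNIV. rate_law \<mu> v)"

abbreviation conf_space :: "(nat \<times> nat \<Rightarrow> real) measure" where
  "conf_space \<equiv> \<Pi>\<^sub>M v\<in>UNIV. borel"

lemma sets_rate_law [measurable_cong]: "sets (rate_law \<mu> v) = sets borel"
  by (simp add: rate_law_def)

lemma space_rate_law [simp]: "space (rate_law \<mu> v) = UNIV"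
  by (simp add: rate_law_def)

lemma sets_lpp_law: "sets (lpp_law \<mu>) = sets conf_space"
  unfolding lpp_law_def by (intro sets_PiM_cong) (auto simp: sets_rate_law)

lemma measurable_lpp_lawI: "f \<in> conf_space \<rightarrow>\<^sub>M N \<Longrightarrow> f \<in> lpp_law \<mu> \<rightarrow>\<^sub>M N"
  using measurable_cong_sets[OF sets_lpp_law refl, of \<mu> N] by (simp only:)

lemma space_lpp_law [simp]: "space (lpp_law \<mu>) = UNIV"
  by (simp add: lpp_law_def space_PiM)

lemma space_conf_space [simp]: "space conf_space = UNIV"
  by (simp add: space_PiM)

lemma prob_space_rate_law: "(\<And>v. 0 < \<mu> v) \<Longrightarrow> prob_space (rate_law \<mu> v)"
  unfolding rate_law_def by (cases "v = (0, 0)") (simp_all add: prob_space_return prob_space_exponential_density)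

lemma prob_space_lpp_law: "(\<And>v. 0 < \<mu> v) \<Longrightarrow> prob_space (lpp_law \<mu>)"
  unfolding lpp_law_def by (intro prob_space_PiM prob_space_rate_law)

lemma measurable_conf_upd [measurable (raw)]:
  assumes "f \<in> M \<rightarrow>\<^sub>M conf_space" "g \<in> borel_measurable M"
  shows "(\<lambda>z. (f z)(v := g z)) \<in> M \<rightarrow>\<^sub>M conf_space"
  using assms by (intro measurable_fun_upd[where J = UNIV]) auto

lemma measurable_conf_apply:
  "(\<lambda>\<omega>. \<omega> v) \<in> borel_measurable conf_space"
  by (rule measurable_component_singleton) simp

text \<open>Replacing one coordinate by an independent fresh copy does not change the law. The set \<open>I\<close> is \<open>UNIV\<close> or
\<open>- {v}\<close>: the latter form lets the law of the coordinate \<open>v\<close> be varied while the rest stays fixed.\<close>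
lemma nn_integral_resample_insert:
  assumes pos: "\<And>v. 0 < \<mu> v" and F: "F \<in> borel_measurable conf_space" and I: "insert v I = UNIV"
  shows "(\<integral>\<^sup>+\<omega>. F \<omega> \<partial>lpp_law \<mu>) = (\<integral>\<^sup>+\<omega>. \<integral>\<^sup>+x. F ((\<omega>)(v := x)) \<partial>rate_law \<mu> v \<partial>PiM I (rate_law \<mu>))"
proof -
  have ps: "prob_space (PiM I (rate_law \<mu>))" "prob_space (rate_law \<mu> v)"
    using pos by (auto intro!: prob_space_PiM prob_space_rate_law)
  interpret pair_prob_space "rate_law \<mu> v" "PiM I (rate_law \<mu>)"
    using ps by (simp add: pair_prob_space_def pair_sigma_finite_def prob_space_imp_sigma_finite)
  have upd [measurable]: "(\<lambda>(x, X). X(v := x)) \<in> rate_law \<mu> v \<Otimes>\<^sub>M PiM I (rate_law \<mu>) \<rightarrow>\<^sub>M lpp_law \<mu>"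
    unfolding lpp_law_def case_prod_beta' by (rule measurable_fun_upd[where J = I]) (use I in auto)
  have eq: "distr (rate_law \<mu> v \<Otimes>\<^sub>M PiM I (rate_law \<mu>)) (lpp_law \<mu>) (\<lambda>(x, X). X(v := x)) = lpp_law \<mu>"
    using distr_pair_PiM_eq_PiM[of I "rate_law \<mu>" v] pos I by (simp add: lpp_law_def prob_space_rate_law)
  have [measurable]: "F \<in> borel_measurable (lpp_law \<mu>)"
    using F by (simp add: measurable_cong_sets[OF sets_lpp_law refl])
  have "(\<integral>\<^sup>+\<omega>. F \<omega> \<partial>lpp_law \<mu>) = (\<integral>\<^sup>+z. F ((snd z)(v := fst z)) \<partial>(rate_law \<mu> v \<Otimes>\<^sub>M PiM I (rate_law \<mu>)))"
    by (subst eq[symmetric], subst nn_integral_distr) (auto simp: case_prod_beta')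
  also have "\<dots> = (\<integral>\<^sup>+\<omega>. \<integral>\<^sup>+x. F ((\<omega>)(v := x)) \<partial>rate_law \<mu> v \<partial>PiM I (rate_law \<mu>))"
    using measurable_compose[OF upd, of F borel] by (subst nn_integral_snd[symmetric]) (auto simp: case_prod_beta')
  finally show ?thesis .
qed

lemma nn_integral_resample:
  assumes "\<And>v. 0 < \<mu> v" "F \<in> borel_measurable conf_space"
  shows "(\<integral>\<^sup>+\<omega>. F \<omega> \<partial>lpp_law \<mu>) = (\<integral>\<^sup>+\<omega>. \<integral>\<^sup>+x. F ((\<omega>)(v := x)) \<partial>rate_law \<mu> v \<partial>lpp_law \<mu>)"
  using nn_integral_resample_insert[OF assms, of v UNIV] by (simp add: lpp_law_def)

lemma nn_integral_exp_law_tilt: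
  assumes "0 < l" "s < l" and [measurable]: "g \<in> borel_measurable borel"
  shows "(\<integral>\<^sup>+x. g x * ennreal (exp (s * x)) \<partial>exp_law l) = ennreal (l / (l - s)) * (\<integral>\<^sup>+x. g x \<partial>exp_law (l - s))"
proof -
  have dens: "ennreal (exponential_density l x) * (g x * ennreal (exp (s * x))) =
      ennreal (l / (l - s)) * (ennreal (exponential_density (l - s) x) * g x)" for x
  proof -
    have "exponential_density l x * exp (s * x) = l / (l - s) * exponential_density (l - s) x"
    proof -
      have "exp (- x * l) * exp (s * x) = exp (- x * (l - s))"
        by (simp add: algebra_simps flip: exp_add)
      then show ?thesis using assms by (simp add: exponential_density_def)
    qed
    moreover have "0 \<le> exponential_density l x" "0 \<le> exponential_density (l - s) x"
      using assms by (auto intro!: exponential_density_nonneg)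
    ultimately have "ennreal (exponential_density l x) * ennreal (exp (s * x)) =
        ennreal (l / (l - s)) * ennreal (exponential_density (l - s) x)"
      using assms by (simp flip: ennreal_mult)
    then show ?thesis by (metis mult.assoc mult.commute)
  qed
  have "(\<integral>\<^sup>+x. g x * ennreal (exp (s * x)) \<partial>exp_law l) =
      (\<integral>\<^sup>+x. ennreal (exponential_density l x) * (g x * ennreal (exp (s * x))) \<partial>lborel)"
    by (intro nn_integral_density) measurable
  also have "\<dots> = ennreal (l / (l - s)) * (\<integral>\<^sup>+x. ennreal (exponential_density (l - s) x) * g x \<partial>lborel)"
    unfolding dens by (intro nn_integral_cmult) measurable
  also have "(\<integral>\<^sup>+x. ennreal (exponential_density (l - s) x) * g x \<partial>lborel) = (\<integral>\<^sup>+x. g x \<partial>exp_law (l - s))"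
    by (intro nn_integral_density[symmetric]) measurable
  finally show ?thesis .
qed

lemma nn_integral_lpp_law_tilt_one:
  assumes pos: "\<And>v. 0 < \<mu> v" and s: "s < \<mu> v" and v: "v \<noteq> (0, 0)"
    and F: "F \<in> borel_measurable conf_space"
  shows "(\<integral>\<^sup>+\<omega>. F \<omega> * ennreal (exp (s * \<omega> v)) \<partial>lpp_law \<mu>) =
    ennreal (\<mu> v / (\<mu> v - s)) * (\<integral>\<^sup>+\<omega>. F \<omega> \<partial>lpp_law (\<mu>(v := \<mu> v - s)))"
proof -
  note [measurable] = F measurable_conf_apply
  let ?P = "PiM (- {v}) (rate_law \<mu>)"
  have sec: "(\<lambda>x. F ((\<omega>)(v := x))) \<in> borel_measurable borel" for \<omega>
    by (rule measurable_compose[OF _ F], rule measurable_fun_upd[where J = UNIV]) (auto simp: space_PiM)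
  interpret L': prob_space "exp_law (\<mu> v - s)" using s by (intro prob_space_exponential_density) auto
  have upd [measurable]: "(\<lambda>z. (fst z)(v := snd z)) \<in> ?P \<Otimes>\<^sub>M exp_law (\<mu> v - s) \<rightarrow>\<^sub>M conf_space"
    by (rule measurable_fun_upd[where J = "- {v}"]) (auto simp: sets_rate_law intro!: measurable_fst'' cong: measurable_cong_sets sets_PiM_cong)
  have "(\<integral>\<^sup>+\<omega>. F \<omega> * ennreal (exp (s * \<omega> v)) \<partial>lpp_law \<mu>) =
      (\<integral>\<^sup>+\<omega>. \<integral>\<^sup>+x. F ((\<omega>)(v := x)) * ennreal (exp (s * x)) \<partial>exp_law (\<mu> v) \<partial>?P)"
    by (subst nn_integral_resample_insert[where v = v and I = "- {v}"]) (use pos v in \<open>auto simp: rate_law_def\<close>)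
  also have "\<dots> = (\<integral>\<^sup>+\<omega>. ennreal (\<mu> v / (\<mu> v - s)) * (\<integral>\<^sup>+x. F ((\<omega>)(v := x)) \<partial>exp_law (\<mu> v - s)) \<partial>?P)"
    by (intro nn_integral_cong nn_integral_exp_law_tilt pos s sec)
  also have "\<dots> = ennreal (\<mu> v / (\<mu> v - s)) * (\<integral>\<^sup>+\<omega>. \<integral>\<^sup>+x. F ((\<omega>)(v := x)) \<partial>exp_law (\<mu> v - s) \<partial>?P)"
    using measurable_compose[OF upd F]
    by (intro nn_integral_cmult L'.borel_measurable_nn_integral) (simp add: case_prod_beta')
  also have "(\<integral>\<^sup>+\<omega>. \<integral>\<^sup>+x. F ((\<omega>)(v := x)) \<partial>exp_law (\<mu> v - s) \<partial>?P) = (\<integral>\<^sup>+\<omega>. F \<omega> \<partial>lpp_law (\<mu>(v := \<mu> v - s)))"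
  proof -
    have "?P = PiM (- {v}) (rate_law (\<mu>(v := \<mu> v - s)))"
      by (intro PiM_cong) (auto simp: rate_law_def)
    then show ?thesis
      by (subst nn_integral_resample_insert[where v = v and I = "- {v}"]) (use pos v s in \<open>auto simp: rate_law_def\<close>)
  qed
  finally show ?thesis .
qed

text \<open>Exponential laws form an exponential family: an exponential weight on finitely many coordinates
only shifts their rates, at the price of the normalising constant.\<close>
lemma nn_integral_lpp_law_tilt:
  assumes pos: "\<And>v. 0 < \<mu> v" and S: "finite S" "(0, 0) \<notin> S" "\<And>v. v \<in> S \<Longrightarrow> s < \<mu> v"
    and F: "F \<in> borel_measurable conf_space"
  shows "(\<integral>\<^sup>+\<omega>. F \<omega> * ennreal (exp (s * (\<Sum>v\<in>S. \<omega> v))) \<partial>lpp_law \<mu>) =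
    ennreal (\<Prod>v\<in>S. \<mu> v / (\<mu> v - s)) * (\<integral>\<^sup>+\<omega>. F \<omega> \<partial>lpp_law (\<lambda>v. if v \<in> S then \<mu> v - s else \<mu> v))"
  using S F
proof (induction S arbitrary: F rule: finite_induct)
  case empty
  then show ?case by simp
next
  case (insert v S)
  note [measurable] = insert.prems(3) measurable_conf_apply
  let ?\<mu> = "\<lambda>u. if u \<in> S then \<mu> u - s else \<mu> u"
  have nn: "0 \<le> (\<Prod>u\<in>S. \<mu> u / (\<mu> u - s))" "0 \<le> \<mu> v / (\<mu> v - s)"
    using insert.prems pos by (intro prod_nonneg divide_nonneg_pos less_imp_le[OF pos]; simp)+
  have "(\<integral>\<^sup>+\<omega>. F \<omega> * ennreal (exp (s * (\<Sum>u\<in>insert v S. \<omega> u))) \<partial>lpp_law \<mu>) =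
      (\<integral>\<^sup>+\<omega>. (F \<omega> * ennreal (exp (s * \<omega> v))) * ennreal (exp (s * (\<Sum>u\<in>S. \<omega> u))) \<partial>lpp_law \<mu>)"
    using insert.hyps by (simp add: distrib_left exp_add ennreal_mult mult.assoc)
  also have "\<dots> = ennreal (\<Prod>u\<in>S. \<mu> u / (\<mu> u - s)) * (\<integral>\<^sup>+\<omega>. F \<omega> * ennreal (exp (s * \<omega> v)) \<partial>lpp_law ?\<mu>)"
    using insert.prems by (intro insert.IH) auto
  also have "(\<integral>\<^sup>+\<omega>. F \<omega> * ennreal (exp (s * \<omega> v)) \<partial>lpp_law ?\<mu>) =
      ennreal (\<mu> v / (\<mu> v - s)) * (\<integral>\<^sup>+\<omega>. F \<omega> \<partial>lpp_law (?\<mu>(v := \<mu> v - s)))"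
    using nn_integral_lpp_law_tilt_one[of ?\<mu> s v F] insert.prems insert.hyps pos by auto
  also have "?\<mu>(v := \<mu> v - s) = (\<lambda>u. if u \<in> insert v S then \<mu> u - s else \<mu> u)"
    by auto
  finally show ?case
    using nn by (simp only: prod.insert[OF insert.hyps] ennreal_mult mult.assoc mult.left_commute)
qed

lemma distr_exp_law_scale:
  assumes "0 < l" "0 < b"
  shows "distr (exp_law l) borel (\<lambda>x. b * x) = exp_law (l / b)"
proof (rule measure_eqI)
  fix A assume "A \<in> sets (distr (exp_law l) borel (\<lambda>x. b * x))"
  then have [measurable]: "A \<in> sets borel" by simp
  have dens: "ennreal b * ennreal (exponential_density (l / b) (b * x)) = ennreal (exponential_density l x)" for x
    using assms by (simp add: exponential_density_def mult_less_0_iff not_less flip: ennreal_mult)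
  have "emeasure (distr (exp_law l) borel (\<lambda>x. b * x)) A = (\<integral>\<^sup>+x. indicator A (b * x) \<partial>exp_law l)"
    by (simp flip: nn_integral_indicator add: nn_integral_distr)
  also have "\<dots> = (\<integral>\<^sup>+x. ennreal (exponential_density l x) * indicator A (b * x) \<partial>lborel)"
    by (intro nn_integral_density) measurable
  also have "\<dots> = ennreal b * (\<integral>\<^sup>+x. ennreal (exponential_density (l / b) (b * x)) * indicator A (b * x) \<partial>lborel)"
    by (subst nn_integral_cmult[symmetric]) (simp_all add: dens flip: mult.assoc)
  also have "\<dots> = (\<integral>\<^sup>+x. ennreal (exponential_density (l / b) x) * indicator A x \<partial>lborel)"
    using assms by (subst (2) nn_integral_real_affine[where t = 0 and c = b]) auto
  also have "\<dots> = emeasure (exp_law (l / b)) A"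
    by (subst emeasure_density) auto
  finally show "emeasure (distr (exp_law l) borel (\<lambda>x. b * x)) A = emeasure (exp_law (l / b)) A" .
qed simp

text \<open>This realises models with different rates on one probability space, so that they can be compared
pathwise.\<close>
lemma distr_scale:
  assumes pos: "\<And>v. 0 < \<mu> v" and c: "\<And>v. 0 < c v"
  shows "distr (lpp_law \<mu>) conf_space (\<lambda>\<omega> v. c v * \<omega> v) = lpp_law (\<lambda>v. \<mu> v / c v)"
proof -
  let ?M = "lpp_law \<mu>"
  interpret prob_space ?M using pos by (rule prob_space_lpp_law)
  note [measurable] = measurable_conf_apply measurable_lpp_lawI[OF measurable_conf_apply]
  have comp: "distr ?M (rate_law \<mu> v) (\<lambda>\<omega>. \<omega> v) = rate_law \<mu> v" for v
    unfolding lpp_law_def using pos by (intro distr_PiM_component prob_space_rate_law) auto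
  have scaled: "distr ?M borel (\<lambda>\<omega>. c v * \<omega> v) = rate_law (\<lambda>v. \<mu> v / c v) v" for v
  proof -
    have "distr ?M borel (\<lambda>\<omega>. c v * \<omega> v) = distr (distr ?M (rate_law \<mu> v) (\<lambda>\<omega>. \<omega> v)) borel (\<lambda>x. c v * x)"
      by (subst distr_distr) (auto simp: comp_def measurable_lpp_lawI[OF measurable_conf_apply] measurable_cong_sets[OF sets_rate_law refl] measurable_cong_sets[OF refl sets_rate_law])
    also have "\<dots> = rate_law (\<lambda>v. \<mu> v / c v) v"
      unfolding comp by (auto simp: rate_law_def distr_exp_law_scale pos c distr_return)
    finally show ?thesis .
  qed
  have "distr ?M (\<Pi>\<^sub>M v\<in>UNIV. rate_law \<mu> v) (\<lambda>\<omega>. \<lambda>v\<in>UNIV. \<omega> v) = (\<Pi>\<^sub>M v\<in>UNIV. distr ?M (rate_law \<mu> v) (\<lambda>\<omega>. \<omega> v))"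
    unfolding comp by (simp add: lpp_law_def restrict_UNIV distr_id2)
  then have "indep_vars (rate_law \<mu>) (\<lambda>v \<omega>. \<omega> v) UNIV"
    by (subst indep_vars_iff_distr_eq_PiM) (auto simp: measurable_cong_sets[OF refl sets_rate_law])
  then have "indep_vars (\<lambda>_. borel) (\<lambda>v \<omega>. c v * \<omega> v) UNIV"
    by (rule indep_vars_compose2[where Y = "\<lambda>v x. c v * x"]) (auto simp: measurable_cong_sets[OF sets_rate_law refl])
  then have eq: "distr ?M conf_space (\<lambda>\<omega>. \<lambda>v\<in>UNIV. c v * \<omega> v) = (\<Pi>\<^sub>M v\<in>UNIV. distr ?M borel (\<lambda>\<omega>. c v * \<omega> v))"
    by (subst (asm) indep_vars_iff_distr_eq_PiM) auto
  note eq
  also have "\<dots> = lpp_law (\<lambda>v. \<mu> v / c v)"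
    by (simp only: scaled lpp_law_def[of "\<lambda>v. \<mu> v / c v"])
  finally show ?thesis by (simp add: restrict_UNIV)
qed

lemma distr_reindex:
  assumes pos: "\<And>v. 0 < \<mu> v" and f: "inj f" "\<And>v. f v = (0, 0) \<longleftrightarrow> v = (0, 0)"
  shows "distr (lpp_law \<mu>) conf_space (\<lambda>\<omega> v. \<omega> (f v)) = lpp_law (\<lambda>v. \<mu> (f v))"
proof -
  have "(\<Pi>\<^sub>M v\<in>UNIV. rate_law \<mu> (f v)) = lpp_law (\<lambda>v. \<mu> (f v))"
    unfolding lpp_law_def by (intro PiM_cong) (auto simp: rate_law_def f(2))
  moreover have "distr (lpp_law \<mu>) (\<Pi>\<^sub>M v\<in>UNIV. rate_law \<mu> (f v)) (\<lambda>\<omega>. \<lambda>v\<in>UNIV. \<omega> (f v)) = (\<Pi>\<^sub>M v\<in>UNIV. rate_law \<mu> (f v))"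
    unfolding lpp_law_def using pos f(1) by (intro distr_PiM_reindex prob_space_rate_law) auto
  moreover have "distr (lpp_law \<mu>) conf_space (\<lambda>\<omega> v. \<omega> (f v)) =
      distr (lpp_law \<mu>) (\<Pi>\<^sub>M v\<in>UNIV. rate_law \<mu> (f v)) (\<lambda>\<omega>. \<lambda>v\<in>UNIV. \<omega> (f v))"
    by (intro distr_cong refl sets_PiM_cong) (auto simp: sets_rate_law)
  ultimately show ?thesis by simp
qed

section \<open>Corner flips\<close>

definition flip :: "nat \<Rightarrow> nat \<Rightarrow> (nat \<times> nat \<Rightarrow> real) \<Rightarrow> nat \<times> nat \<Rightarrow> real" where
  "flip i j \<omega> = (\<omega>)
     ((i, 0) := \<omega> (i, j) + max (\<omega> (i, 0) - \<omega> (0, j)) 0,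
      (0, j) := \<omega> (i, j) + max (\<omega> (0, j) - \<omega> (i, 0)) 0,
      (i, j) := min (\<omega> (i, 0)) (\<omega> (0, j)))"

lemma measurable_flip: "flip i j \<in> conf_space \<rightarrow>\<^sub>M conf_space"
proof -
  note [measurable] = measurable_conf_apply
  show ?thesis unfolding flip_def[abs_def] by measurable
qed

text \<open>The rate condition is that of \<open>burke_corner\<close>; as every coordinate keeps its rate, flips can be iterated.\<close>
lemma nn_integral_flip:
  assumes pos: "\<And>v. 0 < \<mu> v" and ij: "0 < i" "0 < j" and solvable: "\<mu> (i, j) = \<mu> (i, 0) + \<mu> (0, j)"
    and F [measurable]: "F \<in> borel_measurable conf_space"
  shows "(\<integral>\<^sup>+\<omega>. F (flip i j \<omega>) \<partial>lpp_law \<mu>) = (\<integral>\<^sup>+\<omega>. F \<omega> \<partial>lpp_law \<mu>)"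
proof -
  have three: "(\<integral>\<^sup>+\<omega>. H \<omega> \<partial>lpp_law \<mu>) = (\<integral>\<^sup>+\<omega>. \<integral>\<^sup>+x. \<integral>\<^sup>+y. \<integral>\<^sup>+u. H ((\<omega>)((i, 0) := x, (0, j) := y, (i, j) := u))
      \<partial>exp_law (\<mu> (i, 0) + \<mu> (0, j)) \<partial>exp_law (\<mu> (0, j)) \<partial>exp_law (\<mu> (i, 0)) \<partial>lpp_law \<mu>)"
    if [measurable]: "H \<in> borel_measurable conf_space" for H
  proof -
    have law: "rate_law \<mu> (i, 0) = exp_law (\<mu> (i, 0))" "rate_law \<mu> (0, j) = exp_law (\<mu> (0, j))"
       "rate_law \<mu> (i, j) = exp_law (\<mu> (i, 0) + \<mu> (0, j))"
      using ij solvable by (simp_all add: rate_law_def)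
    interpret L1: prob_space "exp_law (\<mu> (i, 0) + \<mu> (0, j))" using pos by (intro prob_space_exponential_density add_pos_pos)
    interpret L2: prob_space "exp_law (\<mu> (0, j))" using pos by (intro prob_space_exponential_density)
    have "(\<integral>\<^sup>+\<omega>. H \<omega> \<partial>lpp_law \<mu>) = (\<integral>\<^sup>+\<omega>. \<integral>\<^sup>+u. H ((\<omega>)((i, j) := u)) \<partial>exp_law (\<mu> (i, 0) + \<mu> (0, j)) \<partial>lpp_law \<mu>)"
      using nn_integral_resample[OF pos that, where v = "(i, j)"] by (simp add: law)
    also have "\<dots> = (\<integral>\<^sup>+\<omega>. \<integral>\<^sup>+y. \<integral>\<^sup>+u. H ((\<omega>)((0, j) := y, (i, j) := u)) \<partial>exp_law (\<mu> (i, 0) + \<mu> (0, j)) \<partial>exp_law (\<mu> (0, j)) \<partial>lpp_law \<mu>)"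
      by (subst nn_integral_resample[OF pos, where v = "(0, j)"]) (simp_all add: law)
    also have "\<dots> = (\<integral>\<^sup>+\<omega>. \<integral>\<^sup>+x. \<integral>\<^sup>+y. \<integral>\<^sup>+u. H ((\<omega>)((i, 0) := x, (0, j) := y, (i, j) := u))
      \<partial>exp_law (\<mu> (i, 0) + \<mu> (0, j)) \<partial>exp_law (\<mu> (0, j)) \<partial>exp_law (\<mu> (i, 0)) \<partial>lpp_law \<mu>)"
      by (subst nn_integral_resample[OF pos, where v = "(i, 0)"]) (simp_all add: law)
    finally show ?thesis .
  qed
  have "(\<integral>\<^sup>+\<omega>. F (flip i j \<omega>) \<partial>lpp_law \<mu>) = (\<integral>\<^sup>+\<omega>. \<integral>\<^sup>+x. \<integral>\<^sup>+y. \<integral>\<^sup>+u.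
      F ((\<omega>)((i, 0) := u + max (x - y) 0, (0, j) := u + max (y - x) 0, (i, j) := min x y))
      \<partial>exp_law (\<mu> (i, 0) + \<mu> (0, j)) \<partial>exp_law (\<mu> (0, j)) \<partial>exp_law (\<mu> (i, 0)) \<partial>lpp_law \<mu>)"
    by (subst three) (use ij in \<open>auto simp: flip_def fun_upd_twist intro!: nn_integral_cong arg_cong[where f = F]\<close>)
  also have "\<dots> = (\<integral>\<^sup>+\<omega>. \<integral>\<^sup>+x. \<integral>\<^sup>+y. \<integral>\<^sup>+u. F ((\<omega>)((i, 0) := x, (0, j) := y, (i, j) := u))
      \<partial>exp_law (\<mu> (i, 0) + \<mu> (0, j)) \<partial>exp_law (\<mu> (0, j)) \<partial>exp_law (\<mu> (i, 0)) \<partial>lpp_law \<mu>)"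
  proof (rule nn_integral_cong)
    fix \<omega> :: "nat \<times> nat \<Rightarrow> real"
    show "(\<integral>\<^sup>+x. \<integral>\<^sup>+y. \<integral>\<^sup>+u.
      F ((\<omega>)((i, 0) := u + max (x - y) 0, (0, j) := u + max (y - x) 0, (i, j) := min x y))
      \<partial>exp_law (\<mu> (i, 0) + \<mu> (0, j)) \<partial>exp_law (\<mu> (0, j)) \<partial>exp_law (\<mu> (i, 0))) =
      (\<integral>\<^sup>+x. \<integral>\<^sup>+y. \<integral>\<^sup>+u. F ((\<omega>)((i, 0) := x, (0, j) := y, (i, j) := u))
      \<partial>exp_law (\<mu> (i, 0) + \<mu> (0, j)) \<partial>exp_law (\<mu> (0, j)) \<partial>exp_law (\<mu> (i, 0)))"
      using pos burke_corner[of "\<mu> (i, 0)" "\<mu> (0, j)" "\<lambda>(x, y, u). F ((\<omega>)((i, 0) := x, (0, j) := y, (i, j) := u))"]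
      by simp
  qed
  also have "\<dots> = (\<integral>\<^sup>+\<omega>. F \<omega> \<partial>lpp_law \<mu>)"
    by (subst three) simp_all
  finally show ?thesis .
qed

lemma distr_flip:
  assumes "\<And>v. 0 < \<mu> v" "0 < i" "0 < j" "\<mu> (i, j) = \<mu> (i, 0) + \<mu> (0, j)"
  shows "distr (lpp_law \<mu>) conf_space (flip i j) = lpp_law \<mu>"
proof (rule measure_eqI)
  fix A assume "A \<in> sets (distr (lpp_law \<mu>) conf_space (flip i j))"
  then have [measurable]: "A \<in> sets conf_space" by simp
  have "emeasure (distr (lpp_law \<mu>) conf_space (flip i j)) A = (\<integral>\<^sup>+\<omega>. indicator A (flip i j \<omega>) \<partial>lpp_law \<mu>)"
    by (simp flip: nn_integral_indicator add: nn_integral_distr measurable_lpp_lawI[OF measurable_flip])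
  also have "\<dots> = emeasure (lpp_law \<mu>) A"
    using nn_integral_flip[OF assms, of "indicator A"] by (simp add: sets_lpp_law)
  finally show "emeasure (distr (lpp_law \<mu>) conf_space (flip i j)) A = emeasure (lpp_law \<mu>) A" .
qed (simp add: sets_lpp_law)

section \<open>Last-passage times and their increments\<close>

text \<open>The weight of the origin is left out: it is common to all paths from the origin.\<close>
fun lpp :: "(nat \<times> nat \<Rightarrow> real) \<Rightarrow> nat \<Rightarrow> nat \<Rightarrow> real" where
  "lpp \<omega> 0 0 = 0"
| "lpp \<omega> (Suc i) 0 = lpp \<omega> i 0 + \<omega> (Suc i, 0)"
| "lpp \<omega> 0 (Suc j) = lpp \<omega> 0 j + \<omega> (0, Suc j)"
| "lpp \<omega> (Suc i) (Suc j) = max (lpp \<omega> i (Suc j)) (lpp \<omega> (Suc i) j) + \<omega> (Suc i, Suc j)"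

text \<open>The last-passage time over the paths that start along the horizontal axis. The value \<open>0\<close> on the
vertical axis is a default that the recursion in the interior never reads.\<close>
fun lpp_hor :: "(nat \<times> nat \<Rightarrow> real) \<Rightarrow> nat \<Rightarrow> nat \<Rightarrow> real" where
  "lpp_hor \<omega> i 0 = lpp \<omega> i 0"
| "lpp_hor \<omega> 0 (Suc j) = 0"
| "lpp_hor \<omega> (Suc 0) (Suc j) = lpp_hor \<omega> (Suc 0) j + \<omega> (Suc 0, Suc j)"
| "lpp_hor \<omega> (Suc (Suc i)) (Suc j) =
     max (lpp_hor \<omega> (Suc i) (Suc j)) (lpp_hor \<omega> (Suc (Suc i)) j) + \<omega> (Suc (Suc i), Suc j)"

definition lpp_ver :: "(nat \<times> nat \<Rightarrow> real) \<Rightarrow> nat \<Rightarrow> nat \<Rightarrow> real" where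
  "lpp_ver \<omega> i j = lpp_hor (\<omega> \<circ> prod.swap) j i"

lemma lpp_swap: "lpp (\<omega> \<circ> prod.swap) j i = lpp \<omega> i j"
  by (induction \<omega> i j rule: lpp.induct) auto

lemma lpp_ver_simps:
  "lpp_ver \<omega> 0 j = lpp \<omega> 0 j"
  "lpp_ver \<omega> (Suc i) (Suc 0) = lpp_ver \<omega> i (Suc 0) + \<omega> (Suc i, Suc 0)"
  "lpp_ver \<omega> (Suc i) (Suc (Suc j)) =
     max (lpp_ver \<omega> i (Suc (Suc j))) (lpp_ver \<omega> (Suc i) (Suc j)) + \<omega> (Suc i, Suc (Suc j))"
  by (simp_all add: lpp_ver_def lpp_swap max.commute)

lemma lpp_eq_max_hor_ver: "lpp \<omega> (Suc i) (Suc j) = max (lpp_hor \<omega> (Suc i) (Suc j)) (lpp_ver \<omega> (Suc i) (Suc j))"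
proof (induction "i + j" arbitrary: i j rule: less_induct)
  case less
  show ?case
  proof (cases i; cases j)
    assume "i = 0" "j = 0"
    then show ?thesis by (simp add: lpp_ver_simps max_def)
  next
    fix j' assume "i = 0" "j = Suc j'"
    then show ?thesis using less[of 0 j'] by (simp add: lpp_ver_simps max_def)
  next
    fix i' assume "i = Suc i'" "j = 0"
    then show ?thesis using less[of i' 0] by (simp add: lpp_ver_simps max_def)
  next
    fix i' j' assume "i = Suc i'" "j = Suc j'"
    then show ?thesis using less[of i' j] less[of i j'] by (simp add: lpp_ver_simps max_def)
  qed
qed

primrec flip_column :: "nat \<Rightarrow> nat \<Rightarrow> (nat \<times> nat \<Rightarrow> real) \<Rightarrow> nat \<times> nat \<Rightarrow> real" where
  "flip_column i 0 \<omega> = \<omega>"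
| "flip_column i (Suc j) \<omega> = flip i (Suc j) (flip_column i j \<omega>)"

text \<open>Columns are flipped from left to right and each column from bottom to top, because the outgoing
increments of a corner are incoming for the corners above it and to its right.\<close>
primrec flip_columns :: "nat \<Rightarrow> nat \<Rightarrow> (nat \<times> nat \<Rightarrow> real) \<Rightarrow> nat \<times> nat \<Rightarrow> real" where
  "flip_columns n 0 \<omega> = \<omega>"
| "flip_columns n (Suc k) \<omega> = flip_column (Suc k) n (flip_columns n k \<omega>)"

text \<open>At the time the corner \<open>(k + 1, j + 1)\<close> is flipped, the axis coordinates of its row and column hold
exactly its incoming increments: the invariant records which axis coordinates have moved on.\<close>
lemma flip_column_increments:
  assumes J: "\<And>y. y < n \<Longrightarrow> \<eta> (0, Suc y) = lpp \<omega> k (Suc y) - lpp \<omega> k y"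
    and later: "\<And>x y. k < x \<Longrightarrow> \<eta> (x, y) = \<omega> (x, y)"
    and "j \<le> n"
  shows "flip_column (Suc k) j \<eta> (Suc k, 0) = lpp \<omega> (Suc k) j - lpp \<omega> k j"
    and "y < n \<Longrightarrow> flip_column (Suc k) j \<eta> (0, Suc y) =
      (if y < j then lpp \<omega> (Suc k) (Suc y) - lpp \<omega> (Suc k) y else lpp \<omega> k (Suc y) - lpp \<omega> k y)"
    and "0 < x \<Longrightarrow> x \<noteq> Suc k \<Longrightarrow> flip_column (Suc k) j \<eta> (x, z) = \<eta> (x, z)"
    and "j < z \<Longrightarrow> flip_column (Suc k) j \<eta> (Suc k, z) = \<eta> (Suc k, z)"
  using \<open>j \<le> n\<close>
proof (induction j arbitrary: x y z)
  case 0
  {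
    case 1 then show ?case using later[of "Suc k" 0] by simp
  next
    case 2 then show ?case using J by simp
  next
    case 3 then show ?case by simp
  next
    case 4 then show ?case by simp
  }
next
  case (Suc j)
  let ?\<eta> = "flip_column (Suc k) j \<eta>"
  have I: "?\<eta> (Suc k, 0) = lpp \<omega> (Suc k) j - lpp \<omega> k j" if "Suc j \<le> n"
    using Suc.IH(1) that by simp
  have J': "?\<eta> (0, Suc j) = lpp \<omega> k (Suc j) - lpp \<omega> k j" if "Suc j \<le> n"
    using Suc.IH(2)[of j] that by simp
  have W: "?\<eta> (Suc k, Suc j) = \<omega> (Suc k, Suc j)" if "Suc j \<le> n"
    using Suc.IH(4)[of "Suc j"] that later by simp
  {
    case 1 then show ?case by (simp add: flip_def I J' W max_def)
  next
    case (2 y) then show ?case using Suc.IH(2)[of y]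
      by (auto simp: flip_def I J' W max_def less_Suc_eq)
  next
    case (3 x z) then show ?case using Suc.IH(3)[of x z] by (simp add: flip_def)
  next
    case (4 z) then show ?case using Suc.IH(4)[of z] by (simp add: flip_def)
  }
qed

lemma flip_columns_increments:
  shows "y < n \<Longrightarrow> flip_columns n k \<omega> (0, Suc y) = lpp \<omega> k (Suc y) - lpp \<omega> k y"
    and "x < k \<Longrightarrow> flip_columns n k \<omega> (Suc x, 0) = lpp \<omega> (Suc x) n - lpp \<omega> x n"
    and "k < x \<Longrightarrow> flip_columns n k \<omega> (x, z) = \<omega> (x, z)"
proof (induction k arbitrary: x y z)
  case 0
  {
    case 1 then show ?case by simp
  next
    case 2 then show ?case by simp
  next
    case 3 then show ?case by simp
  }
next
  case (Suc k)
  note col = flip_column_increments[of n "flip_columns n k \<omega>" \<omega> k n, OF Suc.IH(1) Suc.IH(3) order_refl]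
  {
    case (1 y) then show ?case by (simp add: col(2))
  next
    case (2 x) then show ?case using Suc.IH(2)[of x] by (cases "x = k") (simp_all add: col(1,3))
  next
    case (3 x z) then show ?case using Suc.IH(3)[of x z] by (simp add: col(3))
  }
qed

lemma lpp_axes:
  "lpp \<omega> i 0 = (\<Sum>x<i. \<omega> (Suc x, 0))"
  "lpp \<omega> 0 j = (\<Sum>y<j. \<omega> (0, Suc y))"
  by (induction i; simp) (induction j; simp)

text \<open>Up the vertical axis and then along row \<open>n\<close>: the second sum is, in law, a sum of independent
exponentials.\<close>
lemma lpp_eq_axis_sums:
  "lpp \<omega> m n = (\<Sum>y<n. \<omega> (0, Suc y)) + (\<Sum>x<m. flip_columns n m \<omega> (Suc x, 0))"
proof -
  have "(\<Sum>x<m. flip_columns n m \<omega> (Suc x, 0)) = (\<Sum>x<m. lpp \<omega> (Suc x) n - lpp \<omega> x n)"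
    by (intro sum.cong) (auto simp: flip_columns_increments)
  also have "\<dots> = lpp \<omega> m n - lpp \<omega> 0 n" by (rule sum_lessThan_telescope)
  finally show ?thesis by (simp add: lpp_axes)
qed

text \<open>The vertical axis stays in place because the flips leave the increments along the line \<open>x = k\<close> in the
coordinates \<open>(0, j)\<close>.\<close>
definition shift_index :: "nat \<Rightarrow> nat \<times> nat \<Rightarrow> nat \<times> nat" where
  "shift_index k v = (if fst v = 0 then v else (k + fst v, snd v))"

definition reroot :: "nat \<Rightarrow> nat \<Rightarrow> (nat \<times> nat \<Rightarrow> real) \<Rightarrow> nat \<times> nat \<Rightarrow> real" where
  "reroot n k \<omega> v = flip_columns n k \<omega> (shift_index k v)"

lemma reroot_simps:
  "y < n \<Longrightarrow> reroot n k \<omega> (0, Suc y) = lpp \<omega> k (Suc y) - lpp \<omega> k y"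
  "0 < x \<Longrightarrow> reroot n k \<omega> (x, z) = \<omega> (k + x, z)"
  by (simp_all add: reroot_def shift_index_def flip_columns_increments)

lemma lpp_reroot:
  assumes "j \<le> n"
  shows "lpp (reroot n k \<omega>) i j = lpp \<omega> (k + i) j - lpp \<omega> k 0"
  using assms
proof (induction i arbitrary: j)
  case 0
  then show ?case by (induction j) (simp_all add: reroot_simps)
next
  case (Suc i)
  note IHi = Suc.IH
  from Suc.prems show ?case
  proof (induction j)
    case 0
    then show ?case using IHi[of 0] by (simp add: reroot_simps)
  next
    case (Suc j)
    then show ?case using IHi[of "Suc j"] by (simp add: reroot_simps max_def)
  qed
qed

section \<open>Paths and the exit point\<close>

lemma up_right_path_induct [consumes 1, case_names start right up]:
  assumes "up_right_path u v \<pi>"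
    and start: "P u [u]"
    and right: "\<And>v \<pi>. up_right_path u v \<pi> \<Longrightarrow> P v \<pi> \<Longrightarrow> P (Suc (fst v), snd v) (\<pi> @ [(Suc (fst v), snd v)])"
    and up: "\<And>v \<pi>. up_right_path u v \<pi> \<Longrightarrow> P v \<pi> \<Longrightarrow> P (fst v, Suc (snd v)) (\<pi> @ [(fst v, Suc (snd v))])"
  shows "P v \<pi>"
  using assms(1)
proof (induction \<pi> arbitrary: v rule: rev_induct)
  case Nil
  then show ?case by (simp add: up_right_path_def)
next
  case (snoc w \<pi>)
  then have w: "w = v" by (simp add: up_right_path_def)
  show ?case
  proof (cases "\<pi> = []")
    case True
    with snoc.prems w show ?thesis using start by (simp add: up_right_path_def)
  next
    case False
    with snoc.prems have path: "up_right_path u (last \<pi>) \<pi>"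
      and step: "v = last \<pi> + (1, 0) \<or> v = last \<pi> + (0, 1)"
      by (auto simp: up_right_path_def successively_append_iff)
    from step show ?thesis
      using right[OF path snoc.IH[OF path]] up[OF path snoc.IH[OF path]] w
      by (cases "last \<pi>") auto
  qed
qed

lemma path_weight_snoc [simp]: "path_weight \<omega> (\<pi> @ [v]) = path_weight \<omega> \<pi> + \<omega> v"
  by (simp add: path_weight_def)

lemma path_weight_singleton [simp]: "path_weight \<omega> [v] = \<omega> v"
  by (simp add: path_weight_def)

lemma lpp_step_ge:
  "lpp \<omega> i j + \<omega> (Suc i, j) \<le> lpp \<omega> (Suc i) j"
  "lpp \<omega> i j + \<omega> (i, Suc j) \<le> lpp \<omega> i (Suc j)"
  by (cases j; simp) (cases i; simp)

lemma path_weight_le_lpp: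
  assumes "up_right_path (0, 0) v \<pi>"
  shows "path_weight \<omega> \<pi> \<le> \<omega> (0, 0) + lpp \<omega> (fst v) (snd v)"
  using assms
proof (induction rule: up_right_path_induct)
  case (right v \<pi>)
  then show ?case using lpp_step_ge(1)[of \<omega> "fst v" "snd v"] by simp
next
  case (up v \<pi>)
  then show ?case using lpp_step_ge(2)[of \<omega> "fst v" "snd v"] by simp
qed simp

lemma up_right_path_snoc:
  assumes "up_right_path u v \<pi>" "w = v + (1, 0) \<or> w = v + (0, 1)"
  shows "up_right_path u w (\<pi> @ [w])"
  using assms by (auto simp: up_right_path_def successively_append_iff)

lemma lpp_attained: "\<exists>\<pi>. up_right_path (0, 0) (i, j) \<pi> \<and> path_weight \<omega> \<pi> = \<omega> (0, 0) + lpp \<omega> i j"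
proof (induction \<omega> i j rule: lpp.induct)
  case (1 \<omega>)
  then show ?case by (intro exI[of _ "[(0, 0)]"]) (simp add: up_right_path_def)
next
  case (2 \<omega> i)
  then obtain \<pi> where "up_right_path (0, 0) (i, 0) \<pi>" "path_weight \<omega> \<pi> = \<omega> (0, 0) + lpp \<omega> i 0" by blast
  then show ?case
    by (intro exI[of _ "\<pi> @ [(Suc i, 0)]"]) (auto intro: up_right_path_snoc)
next
  case (3 \<omega> j)
  then obtain \<pi> where "up_right_path (0, 0) (0, j) \<pi>" "path_weight \<omega> \<pi> = \<omega> (0, 0) + lpp \<omega> 0 j" by blast
  then show ?case
    by (intro exI[of _ "\<pi> @ [(0, Suc j)]"]) (auto intro: up_right_path_snoc)
next
  case (4 \<omega> i j)
  then obtain \<pi> \<sigma> where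
    "up_right_path (0, 0) (i, Suc j) \<pi>" "path_weight \<omega> \<pi> = \<omega> (0, 0) + lpp \<omega> i (Suc j)"
    "up_right_path (0, 0) (Suc i, j) \<sigma>" "path_weight \<omega> \<sigma> = \<omega> (0, 0) + lpp \<omega> (Suc i) j" by blast
  then show ?case
    by (intro exI[of _ "(if lpp \<omega> (Suc i) j \<le> lpp \<omega> i (Suc j) then \<pi> else \<sigma>) @ [(Suc i, Suc j)]"])
       (auto intro!: up_right_path_snoc simp: max_def)
qed

lemma geodesic_weight:
  assumes "is_geodesic \<omega> (0, 0) (m, n) \<pi>"
  shows "\<omega> (0, 0) + lpp \<omega> m n \<le> path_weight \<omega> \<pi>"
  using assms lpp_attained[of m n \<omega>] by (metis is_geodesic_def)

lemma lpp_hor_step_ge: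
  "0 < i \<Longrightarrow> lpp_hor \<omega> i j + \<omega> (Suc i, j) \<le> lpp_hor \<omega> (Suc i) j"
  "0 < i \<Longrightarrow> lpp_hor \<omega> i j + \<omega> (i, Suc j) \<le> lpp_hor \<omega> i (Suc j)"
  by (cases i; cases j; simp) (cases i; cases "i - 1"; simp)

text \<open>A path through \<open>(k + 1, 0)\<close> passes \<open>(k, 0)\<close> and continues with a horizontal step, so beyond \<open>(k, 0)\<close> it is
a competitor for the horizontal last-passage time of the rerooted model.\<close>
lemma path_weight_le_lpp_hor:
  assumes "up_right_path (0, 0) v \<pi>" "(Suc k, 0) \<in> set \<pi>"
  shows "k < fst v \<and> path_weight \<omega> \<pi> \<le> \<omega> (0, 0) + lpp \<omega> k 0 + lpp_hor (reroot n k \<omega>) (fst v - k) (snd v)"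
  using assms
proof (induction rule: up_right_path_induct)
  case start
  then show ?case by simp
next
  case (right v \<pi>)
  show ?case
  proof (cases "(Suc k, 0) \<in> set \<pi>")
    case True
    then have "k < fst v" using right by simp
    then show ?thesis
      using right.IH[OF True] lpp_hor_step_ge(1)[of "fst v - k" "reroot n k \<omega>" "snd v"]
      by (simp add: reroot_simps Suc_diff_le)
  next
    case False
    then have "v = (k, 0)" using right.prems by (cases v) auto
    then show ?thesis using path_weight_le_lpp[OF right.hyps, of \<omega>] by (simp add: reroot_simps)
  qed
next
  case (up v \<pi>)
  then show ?case
    using lpp_hor_step_ge(2)[of "fst v - k" "reroot n k \<omega>" "snd v"] by (auto simp: reroot_simps)
qed

lemma hor_ge_ver_of_axis_visit:
  assumes path: "up_right_path (0, 0) (m, n) \<pi>" "(Suc k, 0) \<in> set \<pi>" and n: "0 < n"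
    and opt: "\<omega> (0, 0) + lpp \<omega> m n \<le> path_weight \<omega> \<pi>"
  shows "k < m \<and> lpp_ver (reroot n k \<omega>) (m - k) n \<le> lpp_hor (reroot n k \<omega>) (m - k) n"
proof -
  let ?\<eta> = "reroot n k \<omega>"
  have km: "k < m" and le: "path_weight \<omega> \<pi> \<le> \<omega> (0, 0) + lpp \<omega> k 0 + lpp_hor ?\<eta> (m - k) n"
    using path_weight_le_lpp_hor[OF path, of \<omega> n] by auto
  have "lpp \<omega> m n = lpp ?\<eta> (m - k) n + lpp \<omega> k 0"
    using lpp_reroot[of n n k \<omega> "m - k"] km by simp
  with le opt have "lpp ?\<eta> (m - k) n \<le> lpp_hor ?\<eta> (m - k) n" by simp
  moreover obtain i j where "m - k = Suc i" "n = Suc j"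
    using km n by (metis Suc_pred zero_less_diff)
  ultimately show ?thesis using km lpp_eq_max_hor_ver[of ?\<eta> i j] by simp
qed

lemma axis_visit_pred:
  assumes "up_right_path (0, 0) v \<pi>" "(Suc x, 0) \<in> set \<pi>"
  shows "(x, 0) \<in> set \<pi>"
  using assms
proof (induction rule: up_right_path_induct)
  case (right v \<pi>)
  have "v \<in> set \<pi>" using right.hyps by (auto simp: up_right_path_def)
  with right show ?case by (cases v) auto
qed auto

lemma axis_visit_downward:
  assumes "up_right_path (0, 0) v \<pi>" "(x, 0) \<in> set \<pi>" "k \<le> x"
  shows "(k, 0) \<in> set \<pi>"
  using assms(3,2) by (induction x rule: dec_induct) (auto dest: axis_visit_pred[OF assms(1)])

lemma up_right_path_swap:
  assumes "up_right_path u v \<pi>"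
  shows "up_right_path (prod.swap u) (prod.swap v) (map prod.swap \<pi>)"
proof -
  have "successively (\<lambda>x y. y = x + (1, 0) \<or> y = x + (0, 1)) (map prod.swap \<pi>)"
    unfolding successively_map
    by (rule successively_mono[of "\<lambda>x y. y = x + (1, 0) \<or> y = x + (0, 1)"])
       (use assms in \<open>auto simp: up_right_path_def\<close>)
  with assms show ?thesis by (auto simp: up_right_path_def hd_map last_map)
qed

lemma path_weight_swap: "path_weight (\<omega> \<circ> prod.swap) (map prod.swap \<pi>) = path_weight \<omega> \<pi>"
  by (simp add: path_weight_def comp_def)

text \<open>When the geodesic is not unique the exit time is \<open>0\<close>, so \<open>0 < k\<close> guarantees a geodesic. An exit at
distance at least \<open>k\<close> on either axis forces a visit of the \<open>k\<close>-th point of that axis, as paths reach axis points only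
along the axis.\<close>
lemma exit_time_visits:
  assumes k: "0 < k" "int k \<le> \<bar>exit_time \<omega> v\<bar>"
  obtains \<pi> where "is_geodesic \<omega> (0, 0) v \<pi>" "(k, 0) \<in> set \<pi> \<or> (k, 0) \<in> set (map prod.swap \<pi>)"
proof -
  have ex: "\<exists>!\<pi>. is_geodesic \<omega> (0, 0) v \<pi>"
  proof (rule ccontr)
    assume "\<not> ?thesis"
    then have "exit_time \<omega> v = 0" by (simp only: exit_time_def if_False)
    with k show False by simp
  qed
  define \<pi> where "\<pi> = (THE \<pi>. is_geodesic \<omega> (0, 0) v \<pi>)"
  have geo: "is_geodesic \<omega> (0, 0) v \<pi>" unfolding \<pi>_def using ex by (rule theI')
  then have path: "up_right_path (0, 0) v \<pi>" by (simp add: is_geodesic_def)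
  let ?ax = "filter (\<lambda>x. fst x = 0 \<or> snd x = 0) \<pi>"
  obtain x y where e: "exit_point \<pi> = (x, y)" by fastforce
  have "hd \<pi> \<in> set ?ax" using path hd_in_set[of \<pi>] by (auto simp: up_right_path_def)
  then have "exit_point \<pi> \<in> set ?ax"
    unfolding exit_point_def by (intro last_in_set) (metis empty_iff list.set(1))
  then have xy: "(x, y) \<in> set \<pi>" "x = 0 \<or> y = 0" by (auto simp: e)
  have "int k \<le> \<bar>signed_exit \<pi>\<bar>" using k ex by (simp add: exit_time_def \<pi>_def)
  then have "y = 0 \<and> k \<le> x \<or> x = 0 \<and> k \<le> y"
    using xy(2) by (auto simp: signed_exit_def e Let_def split: if_splits)
  then have "(k, 0) \<in> set \<pi> \<or> (k, 0) \<in> set (map prod.swap \<pi>)"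
  proof
    assume "y = 0 \<and> k \<le> x"
    then show ?thesis using axis_visit_downward[OF path, of x k] xy by auto
  next
    assume a: "x = 0 \<and> k \<le> y"
    have "(y, 0) \<in> set (map prod.swap \<pi>)" using xy a by force
    then show ?thesis using axis_visit_downward[of "prod.swap v" "map prod.swap \<pi>" y k] up_right_path_swap[OF path] a by auto
  qed
  with geo that show ?thesis by blast
qed

definition hor_wins :: "nat \<Rightarrow> nat \<Rightarrow> nat \<Rightarrow> (nat \<times> nat \<Rightarrow> real) \<Rightarrow> bool" where
  "hor_wins m n k \<omega> \<longleftrightarrow> lpp_ver (reroot n k \<omega>) (m - k) n \<le> lpp_hor (reroot n k \<omega>) (m - k) n"

text \<open>This is where the exit point leaves the picture: from here on only the two last-passage times of the
rerooted model matter.\<close>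
lemma exit_time_imp_hor_wins:
  assumes "int (Suc k) \<le> \<bar>exit_time \<omega> (m, n)\<bar>" "0 < m" "0 < n"
  shows "k < m \<and> hor_wins m n k \<omega> \<or> k < n \<and> hor_wins n m k (\<omega> \<circ> prod.swap)"
proof -
  obtain \<pi> where geo: "is_geodesic \<omega> (0, 0) (m, n) \<pi>"
    and visit: "(Suc k, 0) \<in> set \<pi> \<or> (Suc k, 0) \<in> set (map prod.swap \<pi>)"
    using exit_time_visits[OF _ assms(1)] by blast
  have path: "up_right_path (0, 0) (m, n) \<pi>" using geo by (simp add: is_geodesic_def)
  have opt: "\<omega> (0, 0) + lpp \<omega> m n \<le> path_weight \<omega> \<pi>" using geo by (rule geodesic_weight)
  from visit show ?thesis
  proof
    assume "(Suc k, 0) \<in> set \<pi>"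
    then show ?thesis
      using hor_ge_ver_of_axis_visit[OF path _ \<open>0 < n\<close> opt, of k] by (simp add: hor_wins_def)
  next
    assume "(Suc k, 0) \<in> set (map prod.swap \<pi>)"
    moreover have "up_right_path (0, 0) (n, m) (map prod.swap \<pi>)"
      using up_right_path_swap[OF path] by simp
    ultimately show ?thesis
      using hor_ge_ver_of_axis_visit[of n m "map prod.swap \<pi>" k "\<omega> \<circ> prod.swap"] opt \<open>0 < m\<close>
      by (simp add: hor_wins_def path_weight_swap lpp_swap)
  qed
qed

section \<open>Measurability and invariance\<close>

lemma measurable_conf_spaceI:
  "(\<And>v. (\<lambda>z. f z v) \<in> borel_measurable M) \<Longrightarrow> f \<in> M \<rightarrow>\<^sub>M conf_space"
  by (rule measurable_PiM_single') auto

lemma measurable_lpp [measurable]: "(\<lambda>\<omega>. lpp \<omega> i j) \<in> borel_measurable conf_space"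
proof (induction i arbitrary: j)
  case 0
  note [measurable] = measurable_conf_apply
  show ?case by (induction j) simp_all
next
  case (Suc i)
  note [measurable] = measurable_conf_apply Suc.IH
  show ?case by (induction j) simp_all
qed

lemma measurable_lpp_hor [measurable]: "(\<lambda>\<omega>. lpp_hor \<omega> i j) \<in> borel_measurable conf_space"
proof (induction i arbitrary: j)
  case 0
  show ?case by (induction j) simp_all
next
  case (Suc i)
  note [measurable] = measurable_conf_apply Suc.IH
  show ?case
  proof (induction j)
    case 0
    show ?case by (simp add: measurable_lpp del: lpp.simps)
  next
    case (Suc j)
    note [measurable] = Suc.IH
    show ?case
    proof (cases i)
      case 0
      have "(\<lambda>\<omega>. lpp_hor \<omega> (Suc i) j + \<omega> (Suc 0, Suc j)) \<in> borel_measurable conf_space"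
        by measurable
      then show ?thesis by (simp add: 0)
    next
      case (Suc i')
      have "(\<lambda>\<omega>. max (lpp_hor \<omega> i (Suc j)) (lpp_hor \<omega> (Suc i) j) + \<omega> (Suc i, Suc j)) \<in> borel_measurable conf_space"
        by measurable
      then show ?thesis by (simp add: Suc)
    qed
  qed
qed

lemma measurable_conf_reindex: "(\<lambda>\<omega> v. \<omega> (f v)) \<in> conf_space \<rightarrow>\<^sub>M conf_space"
  by (rule measurable_conf_spaceI) (rule measurable_conf_apply)

lemma measurable_conf_scale: "(\<lambda>\<omega> v. c v * \<omega> v) \<in> conf_space \<rightarrow>\<^sub>M conf_space"
proof -
  note [measurable] = measurable_conf_apply
  show ?thesis by (rule measurable_conf_spaceI) measurable
qed

lemma measurable_lpp_ver [measurable]: "(\<lambda>\<omega>. lpp_ver \<omega> i j) \<in> borel_measurable conf_space"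
  unfolding lpp_ver_def comp_def
  by (rule measurable_compose[OF measurable_conf_reindex measurable_lpp_hor])

lemma measurable_flip_column: "flip_column i j \<in> conf_space \<rightarrow>\<^sub>M conf_space"
proof (induction j)
  case 0
  have "flip_column i 0 = (\<lambda>\<omega>. \<omega>)" by (intro ext) simp
  then show ?case by simp
next
  case (Suc j)
  have "flip_column i (Suc j) = (\<lambda>\<omega>. flip i (Suc j) (flip_column i j \<omega>))" by (intro ext) simp
  with measurable_compose[OF Suc measurable_flip] show ?case by (simp only:)
qed

lemma measurable_flip_columns: "flip_columns n k \<in> conf_space \<rightarrow>\<^sub>M conf_space"
proof (induction k)
  case 0
  have "flip_columns n 0 = (\<lambda>\<omega>. \<omega>)" by (intro ext) simp
  then show ?case by simp
next
  case (Suc k)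
  have "flip_columns n (Suc k) = (\<lambda>\<omega>. flip_column (Suc k) n (flip_columns n k \<omega>))" by (intro ext) simp
  with measurable_compose[OF Suc measurable_flip_column] show ?case by (simp only:)
qed

lemma distr_conf_compose:
  assumes f: "f \<in> conf_space \<rightarrow>\<^sub>M conf_space" and g: "g \<in> conf_space \<rightarrow>\<^sub>M conf_space"
    and "distr (lpp_law \<mu>) conf_space f = lpp_law \<mu>" "distr (lpp_law \<mu>) conf_space g = lpp_law \<nu>"
  shows "distr (lpp_law \<mu>) conf_space (\<lambda>\<omega>. g (f \<omega>)) = lpp_law \<nu>"
proof -
  have "distr (lpp_law \<mu>) conf_space (g \<circ> f) = distr (distr (lpp_law \<mu>) conf_space f) conf_space g"
    by (rule distr_distr[symmetric, OF g measurable_lpp_lawI[OF f]])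
  also have "\<dots> = lpp_law \<nu>" by (simp only: assms(3,4))
  finally show ?thesis by (simp only: comp_def)
qed

lemma distr_lpp_law_id: "distr (lpp_law \<mu>) conf_space (\<lambda>\<omega>. \<omega>) = lpp_law \<mu>"
  by (rule distr_id2) (simp add: sets_lpp_law)

lemma distr_flip_column:
  assumes "\<And>v. 0 < \<mu> v" "\<And>y. y < j \<Longrightarrow> \<mu> (Suc i, Suc y) = \<mu> (Suc i, 0) + \<mu> (0, Suc y)"
  shows "distr (lpp_law \<mu>) conf_space (flip_column (Suc i) j) = lpp_law \<mu>"
  using assms(2)
proof (induction j)
  case 0
  have "flip_column (Suc i) 0 = (\<lambda>\<omega>. \<omega>)" by (intro ext) simp
  then show ?case by (simp only: distr_lpp_law_id)
next
  case (Suc j)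
  have "distr (lpp_law \<mu>) conf_space (\<lambda>\<omega>. flip (Suc i) (Suc j) (flip_column (Suc i) j \<omega>)) = lpp_law \<mu>"
    by (rule distr_conf_compose[OF measurable_flip_column measurable_flip Suc.IH distr_flip])
       (use Suc.prems assms(1) in auto)
  moreover have "flip_column (Suc i) (Suc j) = (\<lambda>\<omega>. flip (Suc i) (Suc j) (flip_column (Suc i) j \<omega>))"
    by (intro ext) simp
  ultimately show ?case by (simp only:)
qed

lemma distr_flip_columns:
  assumes "\<And>v. 0 < \<mu> v"
    and "\<And>x y. x < k \<Longrightarrow> y < n \<Longrightarrow> \<mu> (Suc x, Suc y) = \<mu> (Suc x, 0) + \<mu> (0, Suc y)"
  shows "distr (lpp_law \<mu>) conf_space (flip_columns n k) = lpp_law \<mu>"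
  using assms(2)
proof (induction k)
  case 0
  have "flip_columns n 0 = (\<lambda>\<omega>. \<omega>)" by (intro ext) simp
  then show ?case by (simp only: distr_lpp_law_id)
next
  case (Suc k)
  have "distr (lpp_law \<mu>) conf_space (\<lambda>\<omega>. flip_column (Suc k) n (flip_columns n k \<omega>)) = lpp_law \<mu>"
    by (rule distr_conf_compose[OF measurable_flip_columns measurable_flip_column Suc.IH distr_flip_column])
       (use Suc.prems assms(1) in auto)
  moreover have "flip_columns n (Suc k) = (\<lambda>\<omega>. flip_column (Suc k) n (flip_columns n k \<omega>))"
    by (intro ext) simp
  ultimately show ?case by (simp only:)
qed

lemma nn_integral_distr_lpp_law:
  assumes "distr (lpp_law \<mu>) conf_space f = lpp_law \<nu>" "f \<in> conf_space \<rightarrow>\<^sub>M conf_space" "F \<in> borel_measurable conf_space"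
  shows "(\<integral>\<^sup>+\<omega>. F (f \<omega>) \<partial>lpp_law \<mu>) = (\<integral>\<^sup>+\<omega>. F \<omega> \<partial>lpp_law \<nu>)"
proof -
  have F: "F \<in> borel_measurable (distr (lpp_law \<mu>) conf_space f)"
    using assms(3) by simp
  have "(\<integral>\<^sup>+\<omega>. F \<omega> \<partial>distr (lpp_law \<mu>) conf_space f) = (\<integral>\<^sup>+\<omega>. F (f \<omega>) \<partial>lpp_law \<mu>)"
    by (rule nn_integral_distr[OF measurable_lpp_lawI[OF assms(2)] F])
  with assms(1) show ?thesis by (simp only:)
qed

section \<open>The moment generating function\<close>

text \<open>Tilting the vertical weights by \<open>exp (s \<cdot>)\<close> lowers their rates by \<open>s\<close>, which turns the assumption on the
bulk rates into the rate condition for flips. By \<open>lpp_eq_axis_sums\<close> what remains is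
the exponential moment of the weights on the horizontal axis after flipping, hence, by invariance,
before flipping. The tail bounds use it with both signs of \<open>s\<close>.\<close>
lemma nn_integral_exp_lpp:
  assumes pos: "\<And>v. 0 < \<mu> v"
    and hor: "\<And>x. x < m \<Longrightarrow> s < \<mu> (Suc x, 0)" and ver: "\<And>y. y < n \<Longrightarrow> s < \<mu> (0, Suc y)"
    and bulk: "\<And>x y. x < m \<Longrightarrow> y < n \<Longrightarrow> \<mu> (Suc x, Suc y) = \<mu> (Suc x, 0) + \<mu> (0, Suc y) - s"
  shows "(\<integral>\<^sup>+\<omega>. ennreal (exp (s * lpp \<omega> m n)) \<partial>lpp_law \<mu>) =
    ennreal ((\<Prod>x<m. \<mu> (Suc x, 0) / (\<mu> (Suc x, 0) - s)) * (\<Prod>y<n. \<mu> (0, Suc y) / (\<mu> (0, Suc y) - s)))"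
proof -
  let ?V = "(\<lambda>y. (0, Suc y)) ` {..<n}" and ?H = "(\<lambda>x. (Suc x, 0::nat)) ` {..<m}"
  let ?\<nu> = "\<lambda>v. if v \<in> ?V then \<mu> v - s else \<mu> v"
  note [measurable] = measurable_conf_apply
  have sumV: "sum f ?V = (\<Sum>y<n. f (0, Suc y))" "prod f ?V = (\<Prod>y<n. f (0, Suc y))" for f :: "nat \<times> nat \<Rightarrow> real"
    by (subst sum.reindex prod.reindex; auto simp: inj_on_def)+
  have sumH: "sum f ?H = (\<Sum>x<m. f (Suc x, 0))" "prod f ?H = (\<Prod>x<m. f (Suc x, 0))" for f :: "nat \<times> nat \<Rightarrow> real"
    by (subst sum.reindex prod.reindex; auto simp: inj_on_def)+
  have pos': "0 < ?\<nu> v" for v using pos ver by auto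
  have pos'': "0 < (if v \<in> ?H then ?\<nu> v - s else ?\<nu> v)" for v using pos ver hor by auto
  have H: "(\<lambda>\<omega>. ennreal (exp (s * (\<Sum>v\<in>?H. \<omega> v)))) \<in> borel_measurable conf_space"
    by measurable
  note F = measurable_compose[OF measurable_flip_columns H]
  interpret N: prob_space "lpp_law (\<lambda>v. if v \<in> ?H then ?\<nu> v - s else ?\<nu> v)"
    using pos'' by (rule prob_space_lpp_law)
  have "(\<integral>\<^sup>+\<omega>. ennreal (exp (s * lpp \<omega> m n)) \<partial>lpp_law \<mu>) =
     (\<integral>\<^sup>+\<omega>. ennreal (exp (s * (\<Sum>v\<in>?H. flip_columns n m \<omega> v))) * ennreal (exp (s * (\<Sum>v\<in>?V. \<omega> v))) \<partial>lpp_law \<mu>)"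
    unfolding sumV sumH lpp_eq_axis_sums[of _ m n]
    by (simp add: distrib_left exp_add mult.commute flip: ennreal_mult)
  also have "\<dots> = ennreal (\<Prod>v\<in>?V. \<mu> v / (\<mu> v - s)) *
      (\<integral>\<^sup>+\<omega>. ennreal (exp (s * (\<Sum>v\<in>?H. flip_columns n m \<omega> v))) \<partial>lpp_law ?\<nu>)"
    by (rule nn_integral_lpp_law_tilt[OF pos _ _ _ F]) (use ver in auto)
  also have "(\<integral>\<^sup>+\<omega>. ennreal (exp (s * (\<Sum>v\<in>?H. flip_columns n m \<omega> v))) \<partial>lpp_law ?\<nu>) =
      (\<integral>\<^sup>+\<omega>. ennreal (exp (s * (\<Sum>v\<in>?H. \<omega> v))) \<partial>lpp_law ?\<nu>)"
  proof (rule nn_integral_distr_lpp_law[OF _ measurable_flip_columns H])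
    show "distr (lpp_law ?\<nu>) conf_space (flip_columns n m) = lpp_law ?\<nu>"
      by (rule distr_flip_columns[OF pos']) (auto simp: bulk)
  qed
  also have "\<dots> = (\<integral>\<^sup>+\<omega>. 1 * ennreal (exp (s * (\<Sum>v\<in>?H. \<omega> v))) \<partial>lpp_law ?\<nu>)"
    by (simp only: mult_1)
  also have "\<dots> = ennreal (\<Prod>v\<in>?H. ?\<nu> v / (?\<nu> v - s)) *
      (\<integral>\<^sup>+\<omega>. 1 \<partial>lpp_law (\<lambda>v. if v \<in> ?H then ?\<nu> v - s else ?\<nu> v))"
    by (rule nn_integral_lpp_law_tilt[OF pos' _ _ _ borel_measurable_const]) (use hor in auto)
  also have "(\<integral>\<^sup>+\<omega>. 1 \<partial>lpp_law (\<lambda>v. if v \<in> ?H then ?\<nu> v - s else ?\<nu> v)) = 1"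
    using N.emeasure_space_1 by (simp only: nn_integral_const mult_1)
  also have "(\<Prod>v\<in>?H. ?\<nu> v / (?\<nu> v - s)) = (\<Prod>v\<in>?H. \<mu> v / (\<mu> v - s))"
    by (intro prod.cong) auto
  finally have "(\<integral>\<^sup>+\<omega>. ennreal (exp (s * lpp \<omega> m n)) \<partial>lpp_law \<mu>) =
      ennreal (\<Prod>v\<in>?V. \<mu> v / (\<mu> v - s)) * ennreal (\<Prod>v\<in>?H. \<mu> v / (\<mu> v - s))"
    by (simp only: mult_1_right)
  also have "\<dots> = ennreal ((\<Prod>v\<in>?H. \<mu> v / (\<mu> v - s)) * (\<Prod>v\<in>?V. \<mu> v / (\<mu> v - s)))"
  proof -
    have "0 \<le> (\<Prod>v\<in>?H. \<mu> v / (\<mu> v - s))" "0 \<le> (\<Prod>v\<in>?V. \<mu> v / (\<mu> v - s))"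
      using hor ver by (auto intro!: prod_nonneg divide_nonneg_pos less_imp_le[OF pos])
    then show ?thesis by (simp only: ennreal_mult mult.commute)
  qed
  finally show ?thesis by (simp only: sumV sumH)
qed

definition boundary_rates :: "real \<Rightarrow> real \<Rightarrow> nat \<times> nat \<Rightarrow> real" where
  "boundary_rates a b v = (if snd v = 0 then a else if fst v = 0 then b else 1)"

lemma boundary_rates_pos: "0 < a \<Longrightarrow> 0 < b \<Longrightarrow> 0 < boundary_rates a b v"
  by (simp add: boundary_rates_def)

lemma lpp_law_cong: "(\<And>v. v \<noteq> (0, 0) \<Longrightarrow> \<mu> v = \<nu> v) \<Longrightarrow> lpp_law \<mu> = lpp_law \<nu>"
  unfolding lpp_law_def by (intro PiM_cong) (simp_all add: rate_law_def)

lemma stationary_lpp_eq: "stationary_lpp \<rho> = lpp_law (boundary_rates (1 - \<rho>) \<rho>)"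
  unfolding stationary_lpp_def lpp_law_def
  by (intro PiM_cong) (auto simp: rate_law_def weight_law_def boundary_rates_def)

text \<open>A primitive of the mean last-passage time \<open>m / x + n / (1 - x)\<close> of the stationary model.\<close>
definition log_mgf :: "real \<Rightarrow> real \<Rightarrow> real \<Rightarrow> real" where
  "log_mgf m n x = m * ln x - n * ln (1 - x)"

lemma nn_integral_exp_lpp_boundary_rates:
  assumes "0 < z" "z < 1" "0 < w" "w < 1"
  shows "(\<integral>\<^sup>+\<omega>. ennreal (exp ((z - w) * lpp \<omega> m n)) \<partial>lpp_law (boundary_rates z (1 - w))) =
    ennreal (exp (log_mgf m n z - log_mgf m n w))"
proof -
  have "(\<integral>\<^sup>+\<omega>. ennreal (exp ((z - w) * lpp \<omega> m n)) \<partial>lpp_law (boundary_rates z (1 - w))) =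
      ennreal ((z / w) ^ m * ((1 - w) / (1 - z)) ^ n)"
    by (subst nn_integral_exp_lpp) (use assms in \<open>auto simp: boundary_rates_def\<close>)
  also have "(z / w) ^ m * ((1 - w) / (1 - z)) ^ n = exp (m * (ln z - ln w) + n * (ln (1 - w) - ln (1 - z)))"
  proof -
    have "exp (ln z - ln w) = z / w" "exp (ln (1 - w) - ln (1 - z)) = (1 - w) / (1 - z)"
      using assms by (simp_all only: exp_diff exp_ln diff_gt_0_iff_gt)
    then show ?thesis by (simp only: exp_add exp_of_nat_mult)
  qed
  also have "m * (ln z - ln w) + n * (ln (1 - w) - ln (1 - z)) = log_mgf m n z - log_mgf m n w"
    by (simp add: log_mgf_def algebra_simps)
  finally show ?thesis .
qed

lemma lpp_upper_tail:
  assumes "0 < w" "w < z" "z < 1"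
  shows "measure (lpp_law (boundary_rates z (1 - w))) {\<omega>. s \<le> lpp \<omega> m n} \<le>
    exp (log_mgf m n z - log_mgf m n w - (z - w) * s)"
proof -
  define \<mu> where "\<mu> = boundary_rates z (1 - w)"
  have pos: "0 < \<mu> v" for v
    unfolding \<mu>_def using assms by (intro boundary_rates_pos) auto
  interpret prob_space "lpp_law \<mu>"
    using pos by (rule prob_space_lpp_law)
  have lpp: "(\<lambda>\<omega>. lpp \<omega> m n) \<in> borel_measurable (lpp_law \<mu>)"
    by (rule measurable_lpp_lawI[OF measurable_lpp])
  have prod: "(\<lambda>x. lpp x m n * indicator (space (lpp_law \<mu>)) x) \<in> borel_measurable (lpp_law \<mu>)"
    by (rule borel_measurable_times[OF lpp borel_measurable_indicator[OF sets.top]])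
  have "0 < z - w" using assms by simp
  from Chernoff_ineq_nn_integral_ge[OF this sets.top prod, of s]
  have "emeasure (lpp_law \<mu>) {\<omega>. s \<le> lpp \<omega> m n} \<le>
      ennreal (exp (- (z - w) * s)) * (\<integral>\<^sup>+\<omega>. ennreal (exp ((z - w) * lpp \<omega> m n)) \<partial>lpp_law \<mu>)"
    by simp
  also have "(\<integral>\<^sup>+\<omega>. ennreal (exp ((z - w) * lpp \<omega> m n)) \<partial>lpp_law \<mu>) =
      ennreal (exp (log_mgf m n z - log_mgf m n w))"
    unfolding \<mu>_def using assms by (intro nn_integral_exp_lpp_boundary_rates) auto
  also have "ennreal (exp (- (z - w) * s)) * \<dots> =
      ennreal (exp (log_mgf m n z - log_mgf m n w - (z - w) * s))"
  proof -
    have "- (z - w) * s + (log_mgf m n z - log_mgf m n w) = log_mgf m n z - log_mgf m n w - (z - w) * s"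
      by (simp add: algebra_simps)
    then show ?thesis by (simp only: exp_ge_zero flip: ennreal_mult exp_add)
  qed
  finally have "prob {\<omega>. s \<le> lpp \<omega> m n} \<le> exp (log_mgf m n z - log_mgf m n w - (z - w) * s)"
    by (simp add: emeasure_eq_measure)
  then show ?thesis by (simp only: \<mu>_def)
qed

lemma lpp_lower_tail:
  assumes "0 < z" "z < w" "w < 1"
  shows "measure (lpp_law (boundary_rates z (1 - w))) {\<omega>. lpp \<omega> m n \<le> s} \<le>
    exp (log_mgf m n z - log_mgf m n w + (w - z) * s)"
proof -
  define \<mu> where "\<mu> = boundary_rates z (1 - w)"
  have pos: "0 < \<mu> v" for v
    unfolding \<mu>_def using assms by (intro boundary_rates_pos) auto
  interpret prob_space "lpp_law \<mu>"
    using pos by (rule prob_space_lpp_law)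
  have lpp: "(\<lambda>\<omega>. lpp \<omega> m n) \<in> borel_measurable (lpp_law \<mu>)"
    by (rule measurable_lpp_lawI[OF measurable_lpp])
  have "0 < w - z" using assms by simp
  from Chernoff_ineq_nn_integral_le[OF this sets.top lpp, of s]
  have "emeasure (lpp_law \<mu>) {\<omega>. lpp \<omega> m n \<le> s} \<le>
      ennreal (exp ((w - z) * s)) * (\<integral>\<^sup>+\<omega>. ennreal (exp ((z - w) * lpp \<omega> m n)) \<partial>lpp_law \<mu>)"
    by simp
  also have "(\<integral>\<^sup>+\<omega>. ennreal (exp ((z - w) * lpp \<omega> m n)) \<partial>lpp_law \<mu>) =
      ennreal (exp (log_mgf m n z - log_mgf m n w))"
    unfolding \<mu>_def using assms by (intro nn_integral_exp_lpp_boundary_rates) auto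
  also have "ennreal (exp ((w - z) * s)) * \<dots> = ennreal (exp (log_mgf m n z - log_mgf m n w + (w - z) * s))"
    by (simp add: exp_add mult.commute flip: ennreal_mult)
  finally have "prob {\<omega>. lpp \<omega> m n \<le> s} \<le> exp (log_mgf m n z - log_mgf m n w + (w - z) * s)"
    by (simp add: emeasure_eq_measure)
  then show ?thesis by (simp only: \<mu>_def)
qed

lemma pred_ver_le_hor: "Measurable.pred conf_space (\<lambda>\<omega>. lpp_ver \<omega> i j \<le> lpp_hor \<omega> i j)"
  using borel_measurable_le[OF measurable_lpp_ver measurable_lpp_hor, of i j i j] by (simp add: pred_def)

section \<open>Comparing the two axes\<close>

lemma lpp_hor_mono:
  assumes "\<And>x y. 0 < x \<Longrightarrow> \<omega> (x, y) \<le> \<eta> (x, y)"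
  shows "lpp_hor \<omega> i j \<le> lpp_hor \<eta> i j"
  using assms by (induction \<omega> i j rule: lpp_hor.induct) (auto simp: lpp_axes intro!: sum_mono add_mono max.mono)

lemma lpp_hor_cong:
  assumes "\<And>x y. 0 < x \<Longrightarrow> \<omega> (x, y) = \<eta> (x, y)"
  shows "lpp_hor \<omega> i j = lpp_hor \<eta> i j"
  using assms by (intro antisym lpp_hor_mono) auto

lemma lpp_ver_cong:
  assumes "\<And>x y. 0 < y \<Longrightarrow> \<omega> (x, y) = \<eta> (x, y)"
  shows "lpp_ver \<omega> i j = lpp_ver \<eta> i j"
  unfolding lpp_ver_def using assms by (intro lpp_hor_cong) auto

lemma AE_lpp_law_nonneg:
  assumes "\<And>v. 0 < \<mu> v"
  shows "AE \<omega> in lpp_law \<mu>. \<forall>v. 0 \<le> \<omega> v"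
proof -
  have "AE x in rate_law \<mu> v. 0 \<le> x" for v
  proof (cases "v = (0, 0)")
    case True
    then have "rate_law \<mu> v = return borel 0" by (simp add: rate_law_def)
    then show ?thesis by (simp only:) (subst AE_return, auto)
  next
    case False
    then have "rate_law \<mu> v = exp_law (\<mu> v)" by (simp add: rate_law_def)
    then show ?thesis by (simp only:) (subst AE_density, auto simp: exponential_density_def intro!: AE_I2)
  qed
  then have "AE \<omega> in lpp_law \<mu>. 0 \<le> \<omega> v" for v
    unfolding lpp_law_def using assms by (intro AE_PiM_component prob_space_rate_law) auto
  then show ?thesis by (simp add: AE_all_countable)
qed

definition scale_axes :: "real \<Rightarrow> real \<Rightarrow> (nat \<times> nat \<Rightarrow> real) \<Rightarrow> nat \<times> nat \<Rightarrow> real" where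
  "scale_axes \<alpha> \<beta> \<omega> v = (if snd v = 0 then \<alpha> else if fst v = 0 then \<beta> else 1) * \<omega> v"

lemma measurable_scale_axes: "scale_axes \<alpha> \<beta> \<in> conf_space \<rightarrow>\<^sub>M conf_space"
  unfolding scale_axes_def[abs_def] by (rule measurable_conf_scale)

lemma distr_scale_axes:
  assumes "0 < a" "0 < b" "0 < a'" "0 < b'"
  shows "distr (lpp_law (boundary_rates a b)) conf_space (scale_axes (a / a') (b / b')) = lpp_law (boundary_rates a' b')"
proof -
  have "distr (lpp_law (boundary_rates a b)) conf_space (scale_axes (a / a') (b / b')) =
      lpp_law (\<lambda>v. boundary_rates a b v / (if snd v = 0 then a / a' else if fst v = 0 then b / b' else 1))"
    unfolding scale_axes_def[abs_def] using assms by (intro distr_scale boundary_rates_pos) auto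
  also have "\<dots> = lpp_law (boundary_rates a' b')"
    using assms by (intro arg_cong[where f = lpp_law]) (auto simp: boundary_rates_def)
  finally show ?thesis .
qed

lemma measure_distr_lpp_law:
  assumes "distr (lpp_law \<mu>) conf_space f = lpp_law \<nu>" "f \<in> conf_space \<rightarrow>\<^sub>M conf_space" "Measurable.pred conf_space P"
  shows "measure (lpp_law \<mu>) {\<omega>. P (f \<omega>)} = measure (lpp_law \<nu>) {\<omega>. P \<omega>}"
proof -
  have "{\<omega>. P \<omega>} \<in> sets conf_space" using assms(3) by (simp add: pred_def)
  then have "measure (distr (lpp_law \<mu>) conf_space f) {\<omega>. P \<omega>} = measure (lpp_law \<mu>) (f -` {\<omega>. P \<omega>} \<inter> space (lpp_law \<mu>))"
    by (rule measure_distr[OF measurable_lpp_lawI[OF assms(2)]])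
  with assms(1) show ?thesis by (simp add: vimage_def)
qed

text \<open>The stationary weights are scaled in two ways: \<open>\<sigma>\<close> enlarges the horizontal weights only, and \<open>\<tau>\<close> enlarges
them equally but also changes the vertical ones. Thus \<open>\<sigma>\<close> and \<open>\<tau>\<close> yield the same horizontal last-passage
time. If the full time were above \<open>s\<close> for \<open>\<sigma>\<close> and below \<open>s\<close> for \<open>\<tau>\<close>, the former would be attained
vertically, and then \<open>ver\<close> would exceed \<open>s\<close> while \<open>hor\<close> stays below it. The lower tail is
available for \<open>\<sigma>\<close>, since its rates \<open>(z, 1 - a)\<close> have \<open>z < a\<close>, and the upper tail for \<open>\<tau>\<close>.\<close>
lemma prob_ver_le_hor:
  assumes w: "0 < w" "w < z" and z: "z < a" and a: "a < 1" and mn: "0 < m" "0 < n"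
  shows "measure (lpp_law (boundary_rates a (1 - a))) {\<omega>. lpp_ver \<omega> m n \<le> lpp_hor \<omega> m n} \<le>
    exp (log_mgf m n z - log_mgf m n a + (a - z) * s) + exp (log_mgf m n z - log_mgf m n w - (z - w) * s)"
proof -
  let ?M = "lpp_law (boundary_rates a (1 - a))"
  let ?\<sigma> = "scale_axes (a / z) ((1 - a) / (1 - a))" and ?\<tau> = "scale_axes (a / z) ((1 - a) / (1 - w))"
  have pos: "0 < boundary_rates a (1 - a) v" for v using assms by (intro boundary_rates_pos) auto
  interpret prob_space ?M using pos by (rule prob_space_lpp_law)
  have meas: "{\<omega>. lpp (?\<sigma> \<omega>) m n \<le> s} \<in> events" "{\<omega>. s \<le> lpp (?\<tau> \<omega>) m n} \<in> events"
  proof -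
    have [measurable]: "(\<lambda>\<omega>. lpp (scale_axes \<alpha> \<beta> \<omega>) m n) \<in> borel_measurable ?M" for \<alpha> \<beta>
      by (intro measurable_lpp_lawI measurable_compose[OF measurable_scale_axes measurable_lpp])
    have "{\<omega> \<in> space ?M. lpp (?\<sigma> \<omega>) m n \<le> s} \<in> events" "{\<omega> \<in> space ?M. s \<le> lpp (?\<tau> \<omega>) m n} \<in> events"
      by measurable
    then show "{\<omega>. lpp (?\<sigma> \<omega>) m n \<le> s} \<in> events" "{\<omega>. s \<le> lpp (?\<tau> \<omega>) m n} \<in> events"
      by simp_all
  qed
  have "AE \<omega> in ?M. lpp_ver \<omega> m n \<le> lpp_hor \<omega> m n \<longrightarrow>
      lpp (?\<sigma> \<omega>) m n \<le> s \<or> s \<le> lpp (?\<tau> \<omega>) m n"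
    using AE_lpp_law_nonneg[OF pos]
  proof eventually_elim
    case (elim \<omega>)
    obtain i j where ij: "m = Suc i" "n = Suc j" using mn by (metis Suc_pred)
    have "lpp_hor \<omega> m n \<le> lpp_hor (?\<sigma> \<omega>) m n"
    proof (rule lpp_hor_mono)
      fix x y :: nat
      have "1 * \<omega> (x, y) \<le> a / z * \<omega> (x, y)"
        using elim w z by (intro mult_right_mono) auto
      then show "0 < x \<Longrightarrow> \<omega> (x, y) \<le> ?\<sigma> \<omega> (x, y)" by (auto simp: scale_axes_def)
    qed
    moreover have "lpp_hor (?\<tau> \<omega>) m n = lpp_hor (?\<sigma> \<omega>) m n"
      by (intro lpp_hor_cong) (auto simp: scale_axes_def)
    moreover have "lpp_ver (?\<sigma> \<omega>) m n = lpp_ver \<omega> m n"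
      using a by (intro lpp_ver_cong) (auto simp: scale_axes_def)
    moreover have "lpp (?\<sigma> \<omega>) m n = max (lpp_hor (?\<sigma> \<omega>) m n) (lpp_ver (?\<sigma> \<omega>) m n)"
      "lpp (?\<tau> \<omega>) m n = max (lpp_hor (?\<tau> \<omega>) m n) (lpp_ver (?\<tau> \<omega>) m n)"
      unfolding ij by (rule lpp_eq_max_hor_ver)+
    ultimately show ?case by linarith
  qed
  then have "prob {\<omega>. lpp_ver \<omega> m n \<le> lpp_hor \<omega> m n} \<le>
      prob ({\<omega>. lpp (?\<sigma> \<omega>) m n \<le> s} \<union> {\<omega>. s \<le> lpp (?\<tau> \<omega>) m n})"
    using meas by (intro finite_measure_mono_AE) auto
  also have "\<dots> \<le> prob {\<omega>. lpp (?\<sigma> \<omega>) m n \<le> s} + prob {\<omega>. s \<le> lpp (?\<tau> \<omega>) m n}"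
    using meas by (rule measure_Un_le)
  also have "prob {\<omega>. lpp (?\<sigma> \<omega>) m n \<le> s} = measure (lpp_law (boundary_rates z (1 - a))) {\<omega>. lpp \<omega> m n \<le> s}"
    using assms by (intro measure_distr_lpp_law distr_scale_axes measurable_scale_axes) auto
  also have "prob {\<omega>. s \<le> lpp (?\<tau> \<omega>) m n} = measure (lpp_law (boundary_rates z (1 - w))) {\<omega>. s \<le> lpp \<omega> m n}"
    using assms by (intro measure_distr_lpp_law distr_scale_axes measurable_scale_axes) auto
  also have "measure (lpp_law (boundary_rates z (1 - a))) {\<omega>. lpp \<omega> m n \<le> s} \<le>
      exp (log_mgf m n z - log_mgf m n a + (a - z) * s)"
    using assms by (intro lpp_lower_tail) auto
  also have "measure (lpp_law (boundary_rates z (1 - w))) {\<omega>. s \<le> lpp \<omega> m n} \<le>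
      exp (log_mgf m n z - log_mgf m n w - (z - w) * s)"
    using assms by (intro lpp_upper_tail) auto
  finally show ?thesis by simp
qed

text \<open>The bulk rate \<open>1\<close> is the sum of the two axis rates exactly in the stationary model, so flips apply; the
rates do not depend on the column, so the shift of the columns preserves the law as well.\<close>
lemma distr_reroot:
  assumes "0 < a" "a < 1"
  shows "distr (lpp_law (boundary_rates a (1 - a))) conf_space (reroot n k) = lpp_law (boundary_rates a (1 - a))"
proof -
  let ?\<mu> = "boundary_rates a (1 - a)"
  have pos: "0 < ?\<mu> v" for v using assms by (intro boundary_rates_pos) auto
  have "distr (lpp_law ?\<mu>) conf_space (\<lambda>\<omega> v. \<omega> (shift_index k v)) = lpp_law (\<lambda>v. ?\<mu> (shift_index k v))"
    using pos by (rule distr_reindex) (auto simp: shift_index_def inj_def prod_eq_iff split: if_splits)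
  also have "(\<lambda>v. ?\<mu> (shift_index k v)) = ?\<mu>"
    by (auto simp: boundary_rates_def shift_index_def)
  finally have shift: "distr (lpp_law ?\<mu>) conf_space (\<lambda>\<omega> v. \<omega> (shift_index k v)) = lpp_law ?\<mu>" .
  have "distr (lpp_law ?\<mu>) conf_space (flip_columns n k) = lpp_law ?\<mu>"
    using pos by (rule distr_flip_columns) (simp add: boundary_rates_def)
  from distr_conf_compose[OF measurable_flip_columns measurable_conf_reindex this shift]
  show ?thesis unfolding reroot_def[abs_def] .
qed

lemma measurable_reroot: "reroot n k \<in> conf_space \<rightarrow>\<^sub>M conf_space"
  unfolding reroot_def[abs_def] by (rule measurable_compose[OF measurable_flip_columns measurable_conf_reindex])

lemma distr_swap:
  assumes "0 < a" "0 < b"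
  shows "distr (lpp_law (boundary_rates a b)) conf_space (\<lambda>\<omega>. \<omega> \<circ> prod.swap) = lpp_law (boundary_rates b a)"
proof -
  have "distr (lpp_law (boundary_rates a b)) conf_space (\<lambda>\<omega> v. \<omega> (prod.swap v)) = lpp_law (\<lambda>v. boundary_rates a b (prod.swap v))"
    using assms by (intro distr_reindex boundary_rates_pos) auto
  also have "\<dots> = lpp_law (boundary_rates b a)"
    by (rule lpp_law_cong) (auto simp: boundary_rates_def prod_eq_iff)
  finally show ?thesis by (simp add: comp_def)
qed

section \<open>Optimising the Chernoff bounds\<close>

definition log_mgf_deriv :: "real \<Rightarrow> real \<Rightarrow> real \<Rightarrow> real" where
  "log_mgf_deriv m n x = m / x + n / (1 - x)"

lemma log_mgf_above_tangent:
  assumes lo: "0 < lo" "hi < 1"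
    and curv: "\<And>x. lo \<le> x \<Longrightarrow> x \<le> hi \<Longrightarrow> \<kappa> \<le> n / (1 - x)\<^sup>2 - m / x\<^sup>2"
    and x: "lo \<le> x" "x \<le> hi" and y: "lo \<le> y" "y \<le> hi"
  shows "log_mgf m n x + log_mgf_deriv m n x * (y - x) + \<kappa> / 2 * (y - x)\<^sup>2 \<le> log_mgf m n y"
proof -
  let ?f = "\<lambda>t. log_mgf m n t - \<kappa> / 2 * t\<^sup>2" and ?f' = "\<lambda>t. log_mgf_deriv m n t - \<kappa> * t"
    and ?f'' = "\<lambda>t. (n / (1 - t)\<^sup>2 - m / t\<^sup>2) - \<kappa>"
  have "?f' x * (y - x) \<le> ?f y - ?f x"
  proof (rule f''_imp_f'[where C = "{lo..hi}" and f'' = ?f''])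
    fix t assume t: "t \<in> {lo..hi}"
    then have "t \<noteq> 0" "1 - t \<noteq> 0" "0 < t" "t < 1" using lo by auto
    then show "(?f has_real_derivative ?f' t) (at t)"
      unfolding log_mgf_def log_mgf_deriv_def
      by (auto intro!: derivative_eq_intros simp: divide_simps)
    show "(?f' has_real_derivative ?f'' t) (at t)"
      unfolding log_mgf_deriv_def using \<open>t \<noteq> 0\<close> \<open>1 - t \<noteq> 0\<close>
      by (auto intro!: derivative_eq_intros simp: power2_eq_square)
    show "0 \<le> ?f'' t" using curv[of t] t by simp
  qed (use x y in auto)
  then show ?thesis by (simp add: algebra_simps power2_eq_square)
qed

text \<open>For \<open>x = a\<close>, \<open>m = a\<^sup>2 N\<close> and \<open>n = (1 - a)\<^sup>2 N\<close> the curvature vanishes: this is the characteristic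
direction. Removing \<open>K\<close> columns raises it by order \<open>K\<close>, while moving \<open>x\<close> away from \<open>a\<close> by \<open>e\<close> costs order
\<open>e N\<close>, which is absorbed for \<open>e\<close> a small multiple of \<open>K / N\<close>. The lower bound on \<open>K\<close> absorbs the rounding of \<open>n\<close>.\<close>
lemma curvature_off_characteristic:
  fixes a K N m n x :: real
  assumes a: "0 < a" "a < 1" and N: "0 < N"
    and m: "m \<le> a\<^sup>2 * N - K" and n: "(1 - a)\<^sup>2 * N - 1 \<le> n"
    and K: "4 / (1 - a)\<^sup>2 \<le> K"
    and x: "0 < x" "x \<le> a" "a - x \<le> (1 - a)\<^sup>2 / 4 * K / N"
  shows "(1 - a)\<^sup>2 / 4 * K \<le> n / (1 - x)\<^sup>2 - m / x\<^sup>2"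
proof -
  define b where "b = 1 - a"
  define e where "e = a - x"
  have b: "0 < b" "b < 1" "a = 1 - b" and e: "0 \<le> e" "e < a" using a x by (auto simp: b_def e_def)
  have eN: "e * N \<le> b\<^sup>2 / 4 * K" using x(3) N by (simp add: e_def b_def field_simps)
  have K4: "4 \<le> b\<^sup>2 * K" using K b(1) by (simp add: b_def field_simps)
  have xa: "x = a - e" "1 - x = b + e" by (auto simp: e_def b_def)
  have x1: "x\<^sup>2 \<le> 1" "0 < x\<^sup>2" "0 < (1 - x)\<^sup>2" "(1 - x)\<^sup>2 \<le> 1"
    using x a by (auto simp: power_le_one_iff abs_square_le_1)
  have Kpos: "0 < K" using K b by (simp add: b_def[symmetric] order_less_le_trans[OF _ K])
  have cross: "x * b + (1 - x) * a \<le> 2"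
  proof -
    have "x * b \<le> 1" "(1 - x) * a \<le> 1" using x a b by (auto intro!: mult_le_one)
    then show ?thesis by simp
  qed
  have cross0: "0 \<le> x * b + (1 - x) * a" using x a b by simp
  have main: "x\<^sup>2 * b\<^sup>2 - (1 - x)\<^sup>2 * a\<^sup>2 = - e * (x * b + (1 - x) * a)"
  proof -
    have "x\<^sup>2 * b\<^sup>2 - (1 - x)\<^sup>2 * a\<^sup>2 = (x * b - (1 - x) * a) * (x * b + (1 - x) * a)"
      by (simp add: power2_eq_square algebra_simps)
    also have "x * b - (1 - x) * a = - e" by (simp add: b_def e_def algebra_simps)
    finally show ?thesis .
  qed
  have "x\<^sup>2 * n - (1 - x)\<^sup>2 * m \<ge> x\<^sup>2 * (b\<^sup>2 * N - 1) - (1 - x)\<^sup>2 * (a\<^sup>2 * N - K)"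
    using m n by (intro diff_mono mult_left_mono) (auto simp: b_def)
  also have "x\<^sup>2 * (b\<^sup>2 * N - 1) - (1 - x)\<^sup>2 * (a\<^sup>2 * N - K) =
      N * (x\<^sup>2 * b\<^sup>2 - (1 - x)\<^sup>2 * a\<^sup>2) + (1 - x)\<^sup>2 * K - x\<^sup>2"
    by (simp add: algebra_simps)
  also have "\<dots> = - (e * N) * (x * b + (1 - x) * a) + (1 - x)\<^sup>2 * K - x\<^sup>2"
    unfolding main by simp
  finally have 1: "(1 - x)\<^sup>2 * K - x\<^sup>2 - (e * N) * (x * b + (1 - x) * a) \<le> x\<^sup>2 * n - (1 - x)\<^sup>2 * m"
    by simp
  have 2: "(e * N) * (x * b + (1 - x) * a) \<le> (b\<^sup>2 / 4 * K) * 2"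
    using cross0 Kpos by (intro mult_mono[OF eN cross]) simp_all
  have 3: "b\<^sup>2 * K \<le> (1 - x)\<^sup>2 * K"
    using Kpos b e by (intro mult_right_mono power_mono) (auto simp: xa)
  have 4: "b\<^sup>2 / 4 * K \<le> x\<^sup>2 * n - (1 - x)\<^sup>2 * m"
    using 1 2 3 K4 x1 by linarith
  have "n / (1 - x)\<^sup>2 - m / x\<^sup>2 = (x\<^sup>2 * n - (1 - x)\<^sup>2 * m) / (x\<^sup>2 * (1 - x)\<^sup>2)"
    using x1 by (simp add: field_simps)
  moreover have "b\<^sup>2 / 4 * K \<le> (x\<^sup>2 * n - (1 - x)\<^sup>2 * m) / (x\<^sup>2 * (1 - x)\<^sup>2)"
  proof -
    have p: "0 < x\<^sup>2 * (1 - x)\<^sup>2" "x\<^sup>2 * (1 - x)\<^sup>2 \<le> 1" using x1 by (auto intro!: mult_le_one)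
    have "b\<^sup>2 / 4 * K * (x\<^sup>2 * (1 - x)\<^sup>2) \<le> b\<^sup>2 / 4 * K * 1"
      using p Kpos by (intro mult_left_mono) auto
    then show ?thesis using 4 p by (simp add: pos_le_divide_eq)
  qed
  ultimately show ?thesis by (simp add: b_def)
qed

text \<open>The points \<open>a - 2 h < a - h < a\<close> play the roles of \<open>w < z < a\<close> in \<open>prob_ver_le_hor\<close>, with \<open>2 h\<close> the largest
distance from \<open>a\<close> for which the curvature bound is available, and the level \<open>s\<close> is the slope of
\<open>log_mgf\<close> at the middle point; both exponents are then gaps between a convex function and its tangent.\<close>
lemma prob_hor_wins:
  fixes a :: real and N m n k :: nat
  assumes a: "0 < a" "a < 1" and N: "0 < N"
    and m: "real m \<le> a\<^sup>2 * N" and n: "(1 - a)\<^sup>2 * N - 1 \<le> real n"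
    and k: "k < m" "4 / (1 - a)\<^sup>2 \<le> real k"
  shows "measure (lpp_law (boundary_rates a (1 - a))) {\<omega>. hor_wins m n k \<omega>} \<le>
    2 * exp (- ((1 - a) ^ 6 / 512 * real k ^ 3 / real N ^ 2))"
proof -
  let ?M = "lpp_law (boundary_rates a (1 - a))"
  define \<kappa> where "\<kappa> = (1 - a)\<^sup>2 / 4 * real k"
  define h where "h = \<kappa> / (2 * N)"
  have kpos: "0 < real k" using k a by (metis diff_gt_0_iff_gt divide_pos_pos order_less_le_trans zero_less_numeral zero_less_power)
  have \<kappa>: "0 < \<kappa>" using kpos a by (simp add: \<kappa>_def)
  have h: "0 < h" using \<kappa> N by (simp add: h_def)
  have h2: "2 * h = (1 - a)\<^sup>2 / 4 * real k / N" by (simp add: h_def \<kappa>_def)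
  have "2 * h < a"
  proof -
    have "2 * h = (1 - a)\<^sup>2 / 4 * (real k / N)" by (simp add: h2)
    also have "\<dots> \<le> 1 / 4 * a\<^sup>2"
    proof (rule mult_mono)
      have "real k \<le> a\<^sup>2 * N" using k m by simp
      then show "real k / N \<le> a\<^sup>2" using N by (simp add: divide_le_eq)
    qed (use a in \<open>auto simp: abs_square_le_1\<close>)
    also have "\<dots> < a" using a by (simp add: power2_eq_square)
    finally show ?thesis .
  qed
  then have lo: "0 < a - 2 * h" by simp
  have curv: "\<kappa> \<le> real n / (1 - x)\<^sup>2 - real (m - k) / x\<^sup>2" if "a - 2 * h \<le> x" "x \<le> a" for x
    unfolding \<kappa>_def
  proof (rule curvature_off_characteristic[where N = N])
    show "real (m - k) \<le> a\<^sup>2 * real N - real k" using m k by (simp add: of_nat_diff)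
    show "a - x \<le> (1 - a)\<^sup>2 / 4 * real k / real N" using that(1) h2 by linarith
  qed (use a N n k that lo in auto)
  \<comment> \<open>positive curvature at \<open>a\<close> can only come from the term with \<open>n\<close>\<close>
  have n0: "0 < n"
  proof (rule ccontr)
    assume "\<not> ?thesis"
    then have "real n / (1 - a)\<^sup>2 - real (m - k) / a\<^sup>2 \<le> 0" by simp
    with curv[of a] h \<kappa> show False by simp
  qed
  let ?F = "log_mgf (real (m - k)) (real n)" and ?z = "a - h" and ?w = "a - 2 * h"
  let ?s = "log_mgf_deriv (real (m - k)) (real n) ?z"
  note tangent = log_mgf_above_tangent[OF lo a(2) curv]
  have up: "?F ?z - ?F a + (a - ?z) * ?s \<le> - (\<kappa> / 2 * h\<^sup>2)"
    using tangent[of ?z a] h by (simp add: algebra_simps)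
  have down: "?F ?z - ?F ?w - (?z - ?w) * ?s \<le> - (\<kappa> / 2 * h\<^sup>2)"
    using tangent[of ?z ?w] h by (simp add: algebra_simps power2_eq_square)
  have "measure ?M {\<omega>. hor_wins m n k \<omega>} = measure ?M {\<omega>. lpp_ver \<omega> (m - k) n \<le> lpp_hor \<omega> (m - k) n}"
    unfolding hor_wins_def using a
    by (intro measure_distr_lpp_law[where P = "\<lambda>\<omega>. lpp_ver \<omega> (m - k) n \<le> lpp_hor \<omega> (m - k) n"]
        distr_reroot measurable_reroot pred_ver_le_hor) auto
  also have "\<dots> \<le> exp (?F ?z - ?F a + (a - ?z) * ?s) + exp (?F ?z - ?F ?w - (?z - ?w) * ?s)"
    using lo h a k n0 by (intro prob_ver_le_hor) auto
  also have "\<dots> \<le> exp (- (\<kappa> / 2 * h\<^sup>2)) + exp (- (\<kappa> / 2 * h\<^sup>2))"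
    using up down by (intro add_mono) simp_all
  also have "\<kappa> / 2 * h\<^sup>2 = (1 - a) ^ 6 / 512 * real k ^ 3 / real N ^ 2"
    by (simp add: h_def \<kappa>_def power2_eq_square power3_eq_cube eval_nat_numeral field_simps)
  finally show ?thesis by simp
qed

section \<open>The exit-time bound\<close>

lemma prob_exit_time_ge:
  fixes a :: real and N k :: nat
  assumes a: "0 < a" "a < 1" and N: "1 \<le> a\<^sup>2 * N" "1 \<le> (1 - a)\<^sup>2 * N"
    and k: "4 / (1 - a)\<^sup>2 \<le> real k" "4 / a\<^sup>2 \<le> real k"
  shows "measure (stationary_lpp (1 - a))
      {\<omega> \<in> space (stationary_lpp (1 - a)). int (Suc k) \<le> \<bar>exit_time \<omega> (char_point (1 - a) N)\<bar>} \<le>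
    4 * exp (- (min a (1 - a) ^ 6 / 512 * real k ^ 3 / real N ^ 2))"
proof -
  let ?M = "lpp_law (boundary_rates a (1 - a))" and ?M' = "lpp_law (boundary_rates (1 - a) a)"
  define m n where "m = nat \<lfloor>a\<^sup>2 * real N\<rfloor>" and "n = nat \<lfloor>(1 - a)\<^sup>2 * real N\<rfloor>"
  have M: "stationary_lpp (1 - a) = ?M" by (simp add: stationary_lpp_eq)
  have pt: "char_point (1 - a) N = (m, n)" by (simp add: char_point_def m_def n_def)
  have mn: "real m \<le> a\<^sup>2 * N" "a\<^sup>2 * N - 1 \<le> real m" "real n \<le> (1 - a)\<^sup>2 * N" "(1 - a)\<^sup>2 * N - 1 \<le> real n"
    using N unfolding m_def n_def by linarith+
  have mn0: "0 < m" "0 < n" using N by (simp_all add: m_def n_def)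
  have N0: "0 < N" using N by (cases N) auto
  interpret prob_space ?M using a by (intro prob_space_lpp_law boundary_rates_pos) auto
  have hw: "{\<omega>. hor_wins m' n' k' \<omega>} \<in> sets conf_space" for m' n' k'
  proof -
    have "Measurable.pred conf_space (\<lambda>\<omega>. lpp_ver (reroot n' k' \<omega>) (m' - k') n' \<le> lpp_hor (reroot n' k' \<omega>) (m' - k') n')"
      by (rule measurable_compose[OF measurable_reroot pred_ver_le_hor])
    then show ?thesis by (simp add: hor_wins_def pred_def)
  qed
  let ?A = "{\<omega>. k < m \<and> hor_wins m n k \<omega>}" and ?B = "{\<omega>. k < n \<and> hor_wins n m k (\<omega> \<circ> prod.swap)}"
  let ?e = "exp (- (min a (1 - a) ^ 6 / 512 * real k ^ 3 / real N ^ 2))"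
  have swap: "(\<lambda>\<omega>. \<omega> \<circ> prod.swap) \<in> conf_space \<rightarrow>\<^sub>M conf_space"
    unfolding comp_def by (rule measurable_conf_reindex)
  have B': "{\<omega>. hor_wins n m k (\<omega> \<circ> prod.swap)} \<in> sets conf_space"
    using measurable_sets[OF swap hw[of n m k]] by (simp add: vimage_def)
  have AB: "?A \<in> events" "?B \<in> events"
    using hw[of m n k] B' by (cases "k < m"; cases "k < n"; simp add: sets_lpp_law)+
  have le_e: "exp (- (b ^ 6 / 512 * real k ^ 3 / real N ^ 2)) \<le> ?e" if "min a (1 - a) \<le> b" for b
    using that a by (auto intro!: divide_right_mono mult_right_mono power_mono)
  have "prob ?A \<le> 2 * ?e"
  proof (cases "k < m")
    case True
    then have "prob ?A \<le> 2 * exp (- ((1 - a) ^ 6 / 512 * real k ^ 3 / real N ^ 2))"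
      using prob_hor_wins[OF a N0 mn(1,4) True k(1)] by simp
    with le_e[OF min.cobounded2] show ?thesis by linarith
  qed simp
  moreover have "prob ?B \<le> 2 * ?e"
  proof (cases "k < n")
    case True
    have "prob ?B = measure ?M' {\<omega>. hor_wins n m k \<omega>}"
      using True a hw[of n m k] measure_distr_lpp_law[OF distr_swap swap, of a "1 - a" "hor_wins n m k"]
      by (simp add: pred_def)
    also have "\<dots> \<le> 2 * exp (- (a ^ 6 / 512 * real k ^ 3 / real N ^ 2))"
      using prob_hor_wins[of "1 - a" N n m k] a N0 mn True k by simp
    finally show ?thesis using le_e[OF min.cobounded1] by linarith
  qed simp
  moreover have "prob {\<omega>. int (Suc k) \<le> \<bar>exit_time \<omega> (m, n)\<bar>} \<le> prob (?A \<union> ?B)"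
    using AB exit_time_imp_hor_wins[OF _ mn0] by (intro finite_measure_mono) auto
  moreover have "prob (?A \<union> ?B) \<le> prob ?A + prob ?B"
    using AB by (rule measure_Un_le)
  ultimately show ?thesis by (simp add: M pt)
qed

theorem theorem2p4:
  fixes \<rho> :: real
  assumes "0 < \<rho>" and "\<rho> < 1"
  shows "\<exists>(N\<^sub>0::nat) (C::real) (c::real). 0 < N\<^sub>0 \<and> 0 < C \<and> 0 < c \<and>
    (\<forall>(r::real) (N::nat). 0 < r \<longrightarrow> N\<^sub>0 \<le> N \<longrightarrow>
      measure (stationary_lpp \<rho>)
        {\<omega> \<in> space (stationary_lpp \<rho>).
           r * real N powr (2 / 3) \<le> real_of_int \<bar>exit_time \<omega> (char_point \<rho> N)\<bar>}
      \<le> C * exp (- c * r ^ 3))"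
proof -
  define a where "a = 1 - \<rho>"
  have a: "0 < a" "a < 1" and \<rho>: "\<rho> = 1 - a" using assms by (auto simp: a_def)
  define c where "c = min a (1 - a) ^ 6 / 4096"
  \<comment> \<open>for fewer than \<open>B\<close> columns the bound is trivial once the constant is large enough\<close>
  define B where "B = 4 / (1 - a)\<^sup>2 + 4 / a\<^sup>2 + 1"
  \<comment> \<open>makes both coordinates of the endpoint positive\<close>
  define N\<^sub>0 where "N\<^sub>0 = nat \<lceil>1 / a\<^sup>2\<rceil> + nat \<lceil>1 / (1 - a)\<^sup>2\<rceil>"
  have c: "0 < c" using a by (simp add: c_def)
  have B: "1 \<le> B" "4 / (1 - a)\<^sup>2 \<le> B" "4 / a\<^sup>2 \<le> B" by (auto simp: B_def)
  interpret prob_space "stationary_lpp \<rho>" using assms by (rule prob_space_stationary_lpp)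
  have bound: "prob {\<omega> \<in> space (stationary_lpp \<rho>).
         r * real N powr (2 / 3) \<le> real_of_int \<bar>exit_time \<omega> (char_point \<rho> N)\<bar>}
      \<le> 4 * exp (c * (B + 1) ^ 3) * exp (- c * r ^ 3)" (is "prob ?E \<le> _")
    if r: "0 < r" and NN: "N\<^sub>0 \<le> N" for r :: real and N :: nat
  proof -
    have "1 / a\<^sup>2 \<le> real N" "1 / (1 - a)\<^sup>2 \<le> real N"
      using NN unfolding N\<^sub>0_def by linarith+
    then have N: "1 \<le> a\<^sup>2 * N" "1 \<le> (1 - a)\<^sup>2 * N" using a by (simp_all add: field_simps)
    then have Npos: "1 \<le> real N" by (cases N) auto
    define t where "t = r * real N powr (2 / 3)"
    \<comment> \<open>an exit at distance at least \<open>k + 1\<close> crosses \<open>k\<close> full columns or rows\<close>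
    define k where "k = nat \<lceil>t\<rceil> - 1"
    have t0: "0 < t" using r Npos by (simp add: t_def)
    have rt: "r \<le> t" using r Npos ge_one_powr_ge_zero[of "real N" "2 / 3"] by (simp add: t_def)
    have Suck: "int (Suc k) = \<lceil>t\<rceil>" and tk: "t \<le> real k + 1" using t0 unfolding k_def by linarith+
    have t3: "t ^ 3 = r ^ 3 * real N ^ 2"
    proof -
      have "(real N powr (2 / 3)) ^ 3 = real N powr 2"
        using Npos by (simp add: powr_power)
      then show ?thesis using Npos by (simp add: t_def power_mult_distrib)
    qed
    show ?thesis
    proof (cases "B \<le> real k")
      case True
      have "?E = {\<omega> \<in> space (stationary_lpp \<rho>). int (Suc k) \<le> \<bar>exit_time \<omega> (char_point \<rho> N)\<bar>}"
        unfolding Suck t_def[symmetric] ceiling_le_iff ..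
      then have "prob ?E \<le> 4 * exp (- (min a (1 - a) ^ 6 / 512 * real k ^ 3 / real N ^ 2))"
        using prob_exit_time_ge[OF a N, of k] True B by (simp add: \<rho>)
      also have "\<dots> \<le> 4 * exp (- c * r ^ 3)"
      proof -
        have "t ^ 3 \<le> (2 * real k) ^ 3"
          using tk t0 B True by (intro power_mono) auto
        then have "r ^ 3 \<le> 8 * (real k ^ 3 / real N ^ 2)"
          using Npos by (simp add: t3 power_mult_distrib field_simps)
        then have "c * r ^ 3 \<le> c * (8 * (real k ^ 3 / real N ^ 2))"
          using c by (intro mult_left_mono) auto
        then show ?thesis by (simp add: c_def)
      qed
      also have "\<dots> \<le> 4 * exp (c * (B + 1) ^ 3) * exp (- c * r ^ 3)"
        using c B by simp
      finally show ?thesis .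
    next
      case False
      have "r ^ 3 \<le> (B + 1) ^ 3"
        using False rt tk r by (intro power_mono) auto
      then have "c * r ^ 3 \<le> c * (B + 1) ^ 3"
        using c by (intro mult_left_mono) auto
      then have "1 \<le> exp (c * (B + 1) ^ 3) * exp (- c * r ^ 3)"
        by (simp flip: exp_add)
      then show ?thesis using prob_le_1[of ?E] by linarith
    qed
  qed
  have "0 < nat \<lceil>1 / a\<^sup>2\<rceil>" using a by simp
  then have "0 < N\<^sub>0" by (simp add: N\<^sub>0_def)
  with c bound show ?thesis
    by (intro exI[of _ N\<^sub>0] exI[of _ "4 * exp (c * (B + 1) ^ 3)"] exI[of _ c]) auto
qed

end
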